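(* Let $\Gamma$ be an infinite group generated by a finite set $X$. The following are equivalent: (1) $\Gamma$ has solvable UB-generic Word Problem with respect to $X$; (2) there exists a computably enumerable UB-generic set $S\subset\mathbb F_X$ with $S\cap\ker\pi=\emptyset$; (3) there exists a computably enumerable sequence $\{\omega_n\}_{n\in\mathbb N}\subset\mathbb F_X$ such that $|\omega_n|_\Gamma>n$ for all $n\in\mathbb N$; (4) there exists a computably enumerable sequence $\{\omega_n\}_{n\in\mathbb N}\subset\mathbb F_X$ such that $|\omega_{n+1}|_\Gamma>|\omega_n|_\Gamma$ for all $n\in\mathbb N$.
   Context: $\mathbb F_X$ is the free group on $X$, $\pi:\mathbb F_X\to\Gamma$ the canonical epimorphism, $|\omega|$ the reduced word length, $B_n=\{\omega\in\mathbb F_X:|\omega|\le n\}$, and for $\omega\in\mathbb F_X$, $|\omega|_\Gamma$ denotes the word length of $\pi(\omega)$ in $\Gamma$ with respect to $X$, i.e. $\min\{|v|:v\in\mathbb F_X,\pi(v)=\pi(\omega)\}$. $S\subset\mathbb F_X$ is UB-generic if $\limsup_{n\to\infty}\max_{\omega\in\mathbb F_X}\frac{|S\cap\omega B_n|}{|B_n|}=1$. $\Gamma$ has solvable Word Problem on $S$ if there is a partial algorithm halting at least on every $\omega\in S$ and, whenever it halts, correctly deciding whether $\pi(\omega)$ is trivial; $\Gamma$ has solvable UB-generic Word Problem with respect to $X$ if this holds for some UB-generic $S\subset\mathbb F_X$. *)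

theory Defs
  imports Complex_Main "HOL-Algebra.Algebra" "HOL-Library.Nat_Bijection"
    "HOL-Library.Extended_Real" "HOL-Library.Liminf_Limsup"
begin

datatype recf =
    Zf
  | Sf
  | Idf nat
  | Cn recf "recf list"
  | Pr recf recf
  | Mn recf

inductive evalr :: "recf \<Rightarrow> nat list \<Rightarrow> nat \<Rightarrow> bool" where
  zero: "evalr Zf xs 0"
| suc: "evalr Sf (x # xs) (Suc x)"
| ident: "i < length xs \<Longrightarrow> evalr (Idf i) xs (xs ! i)"
| comp: "length ys = length gs \<Longrightarrow> (\<forall>i < length gs. evalr (gs ! i) xs (ys ! i))
           \<Longrightarrow> evalr f ys z \<Longrightarrow> evalr (Cn f gs) xs z"
| pr0: "evalr f xs y \<Longrightarrow> evalr (Pr f g) (0 # xs) y"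
| prS: "evalr (Pr f g) (n # xs) y \<Longrightarrow> evalr g (n # y # xs) z
           \<Longrightarrow> evalr (Pr f g) (Suc n # xs) z"
| mn: "evalr f (n # xs) 0 \<Longrightarrow> (\<forall>m < n. \<exists>y. evalr f (m # xs) (Suc y))
           \<Longrightarrow> evalr (Mn f) xs n"

definition ce_set :: "nat set \<Rightarrow> bool" where
  "ce_set A \<longleftrightarrow> (\<exists>r. \<forall>x. x \<in> A \<longleftrightarrow> (\<exists>y. evalr r [x] y))"

text \<open>A letter (i, b) is the generator x_i if b = False and its inverse if b = True.\<close>
type_synonym letter = "nat \<times> bool"

definition cancels :: "letter \<Rightarrow> letter \<Rightarrow> bool" where
  "cancels a b \<longleftrightarrow> fst a = fst b \<and> snd a \<noteq> snd b"

fun reduced :: "letter list \<Rightarrow> bool" where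
  "reduced (a # b # w) = (\<not> cancels a b \<and> reduced (b # w))"
| "reduced _ = True"

definition FX :: "nat \<Rightarrow> letter list set" where
  "FX k = {w. reduced w \<and> (\<forall>a \<in> set w. fst a < k)}"

fun push :: "letter \<Rightarrow> letter list \<Rightarrow> letter list" where
  "push a [] = [a]"
| "push a (b # u) = (if cancels a b then u else a # b # u)"

definition fmult :: "letter list \<Rightarrow> letter list \<Rightarrow> letter list" where
  "fmult u v = foldr push u v"

definition Ball :: "nat \<Rightarrow> nat \<Rightarrow> letter list set" where
  "Ball k n = {w \<in> FX k. length w \<le> n}"

definition UB_generic :: "nat \<Rightarrow> letter list set \<Rightarrow> bool" where
  "UB_generic k S \<longleftrightarrow>
     limsup (\<lambda>n. ereal (real (Max ((\<lambda>w. card (S \<inter> fmult w ` Ball k n)) ` FX k))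
                         / real (card (Ball k n)))) = 1"

definition code :: "letter list \<Rightarrow> nat" where
  "code w = list_encode (map (\<lambda>(i, b). prod_encode (i, if b then 1 else 0)) w)"

definition ce_words :: "letter list set \<Rightarrow> bool" where
  "ce_words S \<longleftrightarrow> ce_set (code ` S)"

definition computable_seq :: "nat \<Rightarrow> (nat \<Rightarrow> letter list) \<Rightarrow> bool" where
  "computable_seq k \<omega> \<longleftrightarrow> (\<forall>n. \<omega> n \<in> FX k) \<and> (\<exists>r. \<forall>n. evalr r [n] (code (\<omega> n)))"

definition pi_word :: "('g, 'b) monoid_scheme \<Rightarrow> (nat \<Rightarrow> 'g) \<Rightarrow> letter list \<Rightarrow> 'g" where
  "pi_word G gen w = foldr (\<lambda>(i, b) g. (if b then inv\<^bsub>G\<^esub> (gen i) else gen i) \<otimes>\<^bsub>G\<^esub> g) w \<one>\<^bsub>G\<^esub>"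

definition ker_pi :: "('g, 'b) monoid_scheme \<Rightarrow> (nat \<Rightarrow> 'g) \<Rightarrow> nat \<Rightarrow> letter list set" where
  "ker_pi G gen k = {w \<in> FX k. pi_word G gen w = \<one>\<^bsub>G\<^esub>}"

definition gamma_len :: "('g, 'b) monoid_scheme \<Rightarrow> (nat \<Rightarrow> 'g) \<Rightarrow> nat \<Rightarrow> letter list \<Rightarrow> nat" where
  "gamma_len G gen k w = (LEAST m. \<exists>v \<in> FX k. length v = m \<and> pi_word G gen v = pi_word G gen w)"

definition WP_solvable_on :: "('g, 'b) monoid_scheme \<Rightarrow> (nat \<Rightarrow> 'g) \<Rightarrow> nat \<Rightarrow> letter list set \<Rightarrow> bool" where
  "WP_solvable_on G gen k S \<longleftrightarrow>
     (\<exists>r. (\<forall>w \<in> S. \<exists>y. evalr r [code w] y) \<and>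
          (\<forall>w \<in> FX k. \<forall>y. evalr r [code w] y \<longrightarrow> (y = 0 \<longleftrightarrow> pi_word G gen w = \<one>\<^bsub>G\<^esub>)))"

definition UB_generic_WP :: "('g, 'b) monoid_scheme \<Rightarrow> (nat \<Rightarrow> 'g) \<Rightarrow> nat \<Rightarrow> bool" where
  "UB_generic_WP G gen k \<longleftrightarrow> (\<exists>S \<subseteq> FX k. UB_generic k S \<and> WP_solvable_on G gen k S)"

end

theory Submission
  imports Defs
begin

text \<open>A UB-generic set contains a translate \<open>v B\<^sub>n\<close> of every ball, because otherwise every
  point of a larger ball would be close to a point outside the set. If a partial algorithm decides
  the word problem on such a set, then, \<open>\<Gamma>\<close> being infinite, \<open>v\<close> can be moved so far from 1 in
  \<open>\<Gamma>\<close> that \<open>v B\<^sub>n\<close> misses \<open>ker \<pi>\<close>, so dovetailing finds some \<open>v\<close> for which the algorithm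
  answers "nontrivial" on all of \<open>v B\<^sub>n\<close>, and this forces \<open>|v|\<^sub>\<Gamma> > n\<close>. Conversely, if
  \<open>|\<omega>\<^sub>n|\<^sub>\<Gamma> > n\<close>, the union of the translates \<open>\<omega>\<^sub>n B\<^sub>n\<close> is a computably enumerable UB-generic set
  disjoint from the kernel. Dovetailing needs no universal function: each single partial recursive
  function is the limit of total recursive step-bounded approximations, by induction on its
  definition.\<close>

section \<open>Total recursive functions\<close>

text \<open>The generic set \<open>S\<close> in (1) is not assumed decidable or enumerable, so a
  search cannot test whether a translate lies in it. The search asks instead for a certificate: a
  number of steps within which the algorithm answers "nontrivial" on every word of v B_n. Since the
  algorithm is correct on all of \<open>FX k\<close> wherever it halts, a certificate is valid even
  if v B_n leaves \<open>S\<close>; genericity only guarantees that the search ends.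

  To pass from (3) to (4), each new term must beat |w|_\<Gamma> for the previous term w. This number
  need not be computable, but the code of w is a computable upper bound for it, and the term of the
  given sequence at that index is longer.\<close>

definition rec_fun :: "nat \<Rightarrow> (nat list \<Rightarrow> nat) \<Rightarrow> bool" where
  "rec_fun n f \<longleftrightarrow> (\<exists>r. \<forall>xs. length xs = n \<longrightarrow> evalr r xs (f xs))"

named_theorems rec_intros

lemma rec_fun_cong:
  assumes "rec_fun n f" "\<And>xs. length xs = n \<Longrightarrow> f xs = g xs"
  shows "rec_fun n g"
  using assms unfolding rec_fun_def by metis

lemma rec_fun_nth [rec_intros]: "i < n \<Longrightarrow> rec_fun n (\<lambda>e. e ! i)"
  unfolding rec_fun_def using evalr.ident by blast

text \<open>Besides composition, this serves for substitution: with projections among the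
  \<open>gs\<close>, arguments are dropped, added or permuted.\<close>

lemma rec_fun_comp:
  assumes "rec_fun (length gs) f" "\<And>g. g \<in> set gs \<Longrightarrow> rec_fun n g"
  shows "rec_fun n (\<lambda>e. f (map (\<lambda>g. g e) gs))"
proof -
  obtain r where r: "\<And>xs. length xs = length gs \<Longrightarrow> evalr r xs (f xs)"
    using assms(1) unfolding rec_fun_def by blast
  obtain R where R: "\<And>g xs. g \<in> set gs \<Longrightarrow> length xs = n \<Longrightarrow> evalr (R g) xs (g xs)"
    using assms(2) unfolding rec_fun_def by metis
  have "evalr (Cn r (map R gs)) xs (f (map (\<lambda>g. g xs) gs))" if "length xs = n" for xs
    by (rule evalr.comp[where ys = "map (\<lambda>g. g xs) gs"]) (auto simp: R r that)
  then show ?thesis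
    unfolding rec_fun_def by blast
qed

lemma rec_fun_comp1:
  assumes "rec_fun 1 f" "rec_fun n a"
  shows "rec_fun n (\<lambda>e. f [a e])"
  using rec_fun_comp[of "[a]" f n] assms by auto

lemma rec_fun_comp2:
  assumes "rec_fun 2 f" "rec_fun n a" "rec_fun n b"
  shows "rec_fun n (\<lambda>e. f [a e, b e])"
  using rec_fun_comp[of "[a, b]" f n] assms by (auto simp: numeral_2_eq_2)

lemma rec_fun_Suc [rec_intros]:
  assumes "rec_fun n a"
  shows "rec_fun n (\<lambda>e. Suc (a e))"
proof -
  have "rec_fun 1 (\<lambda>e. Suc (hd e))"
    unfolding rec_fun_def by (intro exI[of _ Sf]) (auto simp: length_Suc_conv intro: evalr.suc)
  from rec_fun_comp1[OF this assms] show ?thesis by simp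
qed

lemma rec_fun_const [rec_intros]: "rec_fun n (\<lambda>e. c)"
proof (induction c)
  case 0
  show ?case unfolding rec_fun_def using evalr.zero by blast
next
  case (Suc c)
  then show ?case by (rule rec_fun_Suc)
qed

lemma rec_fun_hd [rec_intros]: "rec_fun (Suc n) hd"
  by (rule rec_fun_cong[OF rec_fun_nth[of 0]]) (auto simp: length_Suc_conv)

text \<open>Weakening: an expression remains recursive under a binder, whose variable sits at the
  front of the list.\<close>

lemma rec_fun_tl:
  assumes "rec_fun n a"
  shows "rec_fun (Suc n) (\<lambda>e. a (tl e))"
proof -
  have "rec_fun (Suc n) (\<lambda>e. a (map (\<lambda>g. g e) (map (\<lambda>i e. e ! Suc i) [0..<n])))"
    by (rule rec_fun_comp) (auto intro!: rec_fun_nth assms)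
  then show ?thesis
  proof (rule rec_fun_cong)
    fix xs :: "nat list" assume "length xs = Suc n"
    then have "map (\<lambda>g. g xs) (map (\<lambda>i e. e ! Suc i) [0..<n]) = tl xs"
      by (intro nth_equalityI) (auto simp: nth_tl)
    then show "a (map (\<lambda>g. g xs) (map (\<lambda>i e. e ! Suc i) [0..<n])) = a (tl xs)"
      by simp
  qed
qed

lemmas rec_fun_nth_tl [rec_intros] = rec_fun_tl[OF rec_fun_nth]
lemmas rec_fun_nth_tl_tl [rec_intros] = rec_fun_tl[OF rec_fun_nth_tl]
lemmas rec_fun_hd_tl [rec_intros] = rec_fun_tl[OF rec_fun_hd]
lemmas rec_fun_hd_tl_tl [rec_intros] = rec_fun_tl[OF rec_fun_hd_tl]

lemma rec_fun_Cons:
  assumes "rec_fun (Suc n) f" "rec_fun n a"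
  shows "rec_fun n (\<lambda>e. f (a e # e))"
proof -
  have "rec_fun n (\<lambda>e. f (map (\<lambda>g. g e) (a # map (\<lambda>i e. e ! i) [0..<n])))"
    by (rule rec_fun_comp) (auto intro: rec_fun_nth assms)
  then show ?thesis
  proof (rule rec_fun_cong)
    fix xs :: "nat list" assume "length xs = n"
    then have "map (\<lambda>g. g xs) (map (\<lambda>i e. e ! i) [0..<n]) = xs"
      by (intro nth_equalityI) auto
    then show "f (map (\<lambda>g. g xs) (a # map (\<lambda>i e. e ! i) [0..<n])) = f (a xs # xs)"
      by simp
  qed
qed

text \<open>The rules for binders push the bound variables onto the front of the argument list.\<close>

lemma rec_fun_rec_nat [rec_intros]:
  assumes "rec_fun n c" "rec_fun n f"
    and "rec_fun (Suc (Suc n)) (\<lambda>e. G (hd e) (hd (tl e)) (tl (tl e)))"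
  shows "rec_fun n (\<lambda>e. rec_nat (f e) (\<lambda>i y. G i y e) (c e))"
proof -
  obtain r where r: "\<And>xs. length xs = n \<Longrightarrow> evalr r xs (f xs)"
    using assms(2) unfolding rec_fun_def by blast
  obtain s where s: "\<And>xs. length xs = Suc (Suc n) \<Longrightarrow>
      evalr s xs (G (hd xs) (hd (tl xs)) (tl (tl xs)))"
    using assms(3) unfolding rec_fun_def by blast
  have "evalr (Pr r s) (m # xs) (rec_nat (f xs) (\<lambda>i y. G i y xs) m)" if "length xs = n" for m xs
  proof (induction m)
    case 0
    then show ?case by (simp add: evalr.pr0 r that)
  next
    case (Suc m)
    then show ?case
      using s[of "m # rec_nat (f xs) (\<lambda>i y. G i y xs) m # xs"] that
      by (auto intro: evalr.prS)
  qed
  then have "rec_fun (Suc n) (\<lambda>e. rec_nat (f (tl e)) (\<lambda>i y. G i y (tl e)) (hd e))"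
    unfolding rec_fun_def by (intro exI[of _ "Pr r s"]) (auto simp: length_Suc_conv)
  from rec_fun_Cons[OF this assms(1)] show ?thesis by simp
qed

lemma rec_fun_Least:
  assumes "rec_fun (Suc n) p" "\<And>xs. length xs = n \<Longrightarrow> \<exists>m. p (m # xs) = 0"
  shows "rec_fun n (\<lambda>e. LEAST m. p (m # e) = 0)"
proof -
  obtain r where r: "\<And>xs. length xs = Suc n \<Longrightarrow> evalr r xs (p xs)"
    using assms(1) unfolding rec_fun_def by blast
  have "evalr (Mn r) xs (LEAST m. p (m # xs) = 0)" (is "evalr _ _ ?m") if len: "length xs = n" for xs
  proof (rule evalr.mn)
    show "evalr r (?m # xs) 0"
      using r[of "?m # xs"] LeastI_ex[OF assms(2)[OF len]] len by simp
    show "\<forall>m < ?m. \<exists>y. evalr r (m # xs) (Suc y)"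
    proof (intro allI impI)
      fix m assume "m < ?m"
      then have "p (m # xs) \<noteq> 0"
        by (rule not_less_Least)
      then show "\<exists>y. evalr r (m # xs) (Suc y)"
        using r[of "m # xs"] len by (cases "p (m # xs)") auto
    qed
  qed
  then show ?thesis
    unfolding rec_fun_def by blast
qed

section \<open>Arithmetic and pairing\<close>

lemma rec_fun_pred:
  assumes "rec_fun n a"
  shows "rec_fun n (\<lambda>e. a e - 1)"
proof -
  have "rec_nat 0 (\<lambda>i y. i) m = m - 1" for m :: nat
    by (cases m) auto
  moreover have "rec_fun n (\<lambda>e. rec_nat 0 (\<lambda>i y. i) (a e))"
    by (intro rec_intros assms)
  ultimately show ?thesis by simp
qed

lemma rec_fun_add [rec_intros]:
  assumes "rec_fun n a" "rec_fun n b"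
  shows "rec_fun n (\<lambda>e. a e + b e)"
proof -
  have "rec_nat l (\<lambda>i y. Suc y) m = l + m" for l m :: nat
    by (induction m) auto
  moreover have "rec_fun n (\<lambda>e. rec_nat (a e) (\<lambda>i y. Suc y) (b e))"
    by (intro rec_intros assms)
  ultimately show ?thesis by simp
qed

lemma rec_fun_mult [rec_intros]:
  assumes "rec_fun n a" "rec_fun n b"
  shows "rec_fun n (\<lambda>e. a e * b e)"
proof -
  have "rec_nat 0 (\<lambda>i y. l + y) m = l * m" for l m :: nat
    by (induction m) auto
  moreover have "rec_fun n (\<lambda>e. rec_nat 0 (\<lambda>i y. a e + y) (b e))"
    by (intro rec_intros rec_fun_tl assms)
  ultimately show ?thesis by simp
qed

lemma rec_fun_diff [rec_intros]:
  assumes "rec_fun n a" "rec_fun n b"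
  shows "rec_fun n (\<lambda>e. a e - b e)"
proof -
  have "rec_nat l (\<lambda>i y. y - 1) m = l - m" for l m :: nat
    by (induction m) auto
  moreover have "rec_fun n (\<lambda>e. rec_nat (a e) (\<lambda>i y. y - 1) (b e))"
    by (intro rec_intros rec_fun_pred assms)
  ultimately show ?thesis by simp
qed

lemma rec_fun_power [rec_intros]:
  assumes "rec_fun n a" "rec_fun n b"
  shows "rec_fun n (\<lambda>e. a e ^ b e)"
proof -
  have "rec_nat 1 (\<lambda>i y. l * y) m = l ^ m" for l m :: nat
    by (induction m) auto
  moreover have "rec_fun n (\<lambda>e. rec_nat 1 (\<lambda>i y. a e * y) (b e))"
    by (intro rec_intros rec_fun_tl assms)
  ultimately show ?thesis by simp
qed

lemma rec_fun_if [rec_intros]: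
  assumes "rec_fun n a" "rec_fun n b" "rec_fun n c" "rec_fun n d"
  shows "rec_fun n (\<lambda>e. if a e = b e then c e else d e)"
proof -
  \<comment> \<open>Truncated subtraction makes \<open>(l - m) + (m - l)\<close> vanish exactly when
    \<open>l = m\<close>; a recursion with constant step then merely distinguishes 0 from positive
    numbers.\<close>
  have "rec_nat u (\<lambda>i y. v) ((l - m) + (m - l)) = (if l = m then u else v)" for l m u v :: nat
    by (cases "(l - m) + (m - l)") auto
  moreover have "rec_fun n (\<lambda>e. rec_nat (c e) (\<lambda>i y. d e) ((a e - b e) + (b e - a e)))"
    by (intro rec_intros rec_fun_tl assms)
  ultimately show ?thesis by simp
qed

lemma rec_fun_sum [rec_intros]:
  assumes "rec_fun n a" "rec_fun (Suc n) (\<lambda>e. G (hd e) (tl e))"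
  shows "rec_fun n (\<lambda>e. \<Sum>i<a e. G i e)"
proof -
  have "rec_nat 0 (\<lambda>i y. y + h i) m = (\<Sum>i<m. h i)" for m and h :: "nat \<Rightarrow> nat"
    by (induction m) auto
  moreover have "rec_fun n (\<lambda>e. rec_nat 0 (\<lambda>i y. y + G i e) (a e))"
  proof (intro rec_intros assms(1))
    \<comment> \<open>The recursion passes index, accumulator and environment; the summand does not
      see the accumulator, so the second entry is projected away.\<close>
    have "rec_fun (Suc (Suc n)) (\<lambda>e. (\<lambda>e. G (hd e) (tl e)) (map (\<lambda>g. g e)
        (hd # map (\<lambda>i e. e ! Suc (Suc i)) [0..<n])))"
      by (rule rec_fun_comp) (auto intro: rec_intros assms)
    then show "rec_fun (Suc (Suc n)) (\<lambda>e. G (hd e) (tl (tl e)))"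
    proof (rule rec_fun_cong)
      fix xs :: "nat list" assume "length xs = Suc (Suc n)"
      then have "map (\<lambda>g. g xs) (map (\<lambda>i e. e ! Suc (Suc i)) [0..<n]) = tl (tl xs)"
        by (intro nth_equalityI) (auto simp: nth_tl)
      then show "G (hd (map (\<lambda>g. g xs) (hd # map (\<lambda>i e. e ! Suc (Suc i)) [0..<n])))
          (tl (map (\<lambda>g. g xs) (hd # map (\<lambda>i e. e ! Suc (Suc i)) [0..<n]))) =
          G (hd xs) (tl (tl xs))"
        by simp
    qed
  qed
  ultimately show ?thesis by simp
qed

lemma rec_fun_div [rec_intros]:
  assumes "rec_fun n a" "rec_fun n b"
  shows "rec_fun n (\<lambda>e. a e div b e)"
proof -
  \<comment> \<open>The quotient counts the positive multiples of \<open>m\<close> up to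
    \<open>l\<close>. For \<open>m = 0\<close> all \<open>l\<close> indices would be counted,
    whereas HOL sets the quotient to 0.\<close>
  have "(if m = 0 then 0 else \<Sum>i<l. if Suc i * m - l = 0 then 1 else 0) = l div m" for l m :: nat
  proof (cases "m = 0")
    case False
    have "{i \<in> {..<l}. Suc i * m - l = 0} = {..<l div m}"
    proof -
      have "i < l" if "i < l div m" for i
        using that div_le_dividend[of l m] by linarith
      moreover have "Suc i * m \<le> l \<longleftrightarrow> i < l div m" for i
        using False less_eq_div_iff_mult_less_eq[of m "Suc i" l] by (simp add: Suc_le_eq)
      ultimately show ?thesis by auto
    qed
    then show ?thesis
      using False by (simp add: sum.If_cases Int_def)
  qed simp
  moreover have "rec_fun n (\<lambda>e. if b e = 0 then 0
      else \<Sum>i<a e. if Suc i * b e - a e = 0 then 1 else 0)"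
    by (intro rec_intros rec_fun_tl assms)
  ultimately show ?thesis by simp
qed

lemma rec_fun_mod [rec_intros]:
  assumes "rec_fun n a" "rec_fun n b"
  shows "rec_fun n (\<lambda>e. a e mod b e)"
  unfolding modulo_nat_def by (intro rec_intros assms)

lemma rec_fun_prod_encode [rec_intros]:
  assumes "rec_fun n a" "rec_fun n b"
  shows "rec_fun n (\<lambda>e. prod_encode (a e, b e))"
  unfolding prod_encode_def triangle_def split by (intro rec_intros assms)

definition pfst :: "nat \<Rightarrow> nat" where "pfst z = fst (prod_decode z)"
definition psnd :: "nat \<Rightarrow> nat" where "psnd z = snd (prod_decode z)"

lemma pfst_prod_encode [simp]: "pfst (prod_encode (a, b)) = a"
  and psnd_prod_encode [simp]: "psnd (prod_encode (a, b)) = b"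
  by (simp_all add: pfst_def psnd_def)

text \<open>Unpairing is a bounded search written as a double sum: both components of
  \<open>z\<close> are at most \<open>z\<close>, and exactly one pair encodes \<open>z\<close>, so a
  single summand survives.\<close>

lemma rec_fun_prod_decode:
  assumes "rec_fun n a" "rec_fun 2 (\<lambda>e. h (e ! 0) (e ! 1))"
  shows "rec_fun n (\<lambda>e. h (pfst (a e)) (psnd (a e)))"
proof -
  have *: "(\<Sum>i<Suc z. \<Sum>j<Suc z. if prod_encode (i, j) = z then h i j else 0) =
      h (pfst z) (psnd z)" for z
  proof -
    obtain a b where z: "z = prod_encode (a, b)"
      by (metis prod_decode_inverse surj_pair)
    have "a < Suc z" "b < Suc z"
      using le_prod_encode_1[of a b] le_prod_encode_2[of b a] z by auto
    moreover have "(\<Sum>i<Suc z. \<Sum>j<Suc z. if prod_encode (i, j) = z then h i j else 0) =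
        (\<Sum>i<Suc z. if i = a then \<Sum>j<Suc z. if j = b then h i j else 0 else 0)"
      by (intro sum.cong refl) (auto simp: z intro!: sum.cong)
    ultimately show ?thesis
      by (simp add: z del: sum.lessThan_Suc)
  qed
  have h: "rec_fun m (\<lambda>e. h (u e) (v e))" if "rec_fun m u" "rec_fun m v" for m u v
    using rec_fun_comp2[OF assms(2) that] by simp
  have "rec_fun n (\<lambda>e. \<Sum>i<Suc (a e). \<Sum>j<Suc (a e).
      if prod_encode (i, j) = a e then h i j else 0)"
    by (intro rec_intros h rec_fun_tl assms)
  then show ?thesis
    unfolding * .
qed

lemma rec_fun_pfst [rec_intros]: "rec_fun n a \<Longrightarrow> rec_fun n (\<lambda>e. pfst (a e))"
  by (rule rec_fun_prod_decode[where h = "\<lambda>i j. i"]) (auto intro: rec_fun_nth)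

lemma rec_fun_psnd [rec_intros]: "rec_fun n a \<Longrightarrow> rec_fun n (\<lambda>e. psnd (a e))"
  by (rule rec_fun_prod_decode[where h = "\<lambda>i j. j"]) (auto intro: rec_fun_nth)

section \<open>Step-bounded approximation\<close>

lemma rec_fun_all_nonzero:
  assumes "\<And>t. t \<in> set ts \<Longrightarrow> rec_fun n t"
  shows "rec_fun n (\<lambda>e. if \<forall>t\<in>set ts. t e \<noteq> 0 then 1 else 0)"
  using assms
proof (induction ts)
  case Nil
  show ?case by (simp add: rec_fun_const)
next
  case (Cons t ts)
  have "rec_fun n (\<lambda>e. if t e = 0 then 0 else (if \<forall>t\<in>set ts. t e \<noteq> 0 then 1 else 0))"
    using Cons by (intro rec_intros) auto
  then show ?case by (rule rec_fun_cong) auto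
qed

inductive_cases evalr_ZfE: "evalr Zf xs y"
inductive_cases evalr_SfE: "evalr Sf xs y"
inductive_cases evalr_IdfE: "evalr (Idf i) xs y"
inductive_cases evalr_CnE: "evalr (Cn f gs) xs y"
inductive_cases evalr_MnE: "evalr (Mn f) xs y"
inductive_cases evalr_PrNilE: "evalr (Pr f g) [] y"
inductive_cases evalr_Pr0E: "evalr (Pr f g) (0 # xs) y"
inductive_cases evalr_PrSE: "evalr (Pr f g) (Suc m # xs) y"

text \<open>\<open>t (s # xs)\<close> is 0 if \<open>r\<close> has not halted on \<open>xs\<close> within the bound \<open>s\<close>, and \<open>Suc y\<close> if it has halted
  with value \<open>y\<close>.\<close>

definition approx :: "recf \<Rightarrow> nat \<Rightarrow> (nat list \<Rightarrow> nat) \<Rightarrow> bool" where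
  "approx r n t \<longleftrightarrow> rec_fun (Suc n) t \<and> (\<forall>xs. length xs = n \<longrightarrow>
     (\<forall>s s' y. t (s # xs) = Suc y \<longrightarrow> s \<le> s' \<longrightarrow> t (s' # xs) = Suc y) \<and>
     (\<forall>y. evalr r xs y \<longleftrightarrow> (\<exists>s. t (s # xs) = Suc y)))"

lemma approxI:
  assumes "rec_fun (Suc n) t"
    and "\<And>xs s s' y. length xs = n \<Longrightarrow> t (s # xs) = Suc y \<Longrightarrow> s \<le> s' \<Longrightarrow> t (s' # xs) = Suc y"
    and "\<And>xs s y. length xs = n \<Longrightarrow> t (s # xs) = Suc y \<Longrightarrow> evalr r xs y"
    and "\<And>xs y. length xs = n \<Longrightarrow> evalr r xs y \<Longrightarrow> \<exists>s. t (s # xs) = Suc y"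
  shows "approx r n t"
  unfolding approx_def using assms by blast

lemma approxD:
  assumes "approx r n t"
  shows approx_rec_fun: "rec_fun (Suc n) t"
    and approx_mono: "length xs = n \<Longrightarrow> t (s # xs) = Suc y \<Longrightarrow> s \<le> s' \<Longrightarrow> t (s' # xs) = Suc y"
    and approx_sound: "length xs = n \<Longrightarrow> t (s # xs) = Suc y \<Longrightarrow> evalr r xs y"
    and approx_complete: "length xs = n \<Longrightarrow> evalr r xs y \<Longrightarrow> \<exists>s. t (s # xs) = Suc y"
  using assms unfolding approx_def by blast+

lemma approx_total:
  assumes "rec_fun n f" "\<And>xs y. length xs = n \<Longrightarrow> evalr r xs y \<longleftrightarrow> y = f xs"
  shows "approx r n (\<lambda>e. Suc (f (tl e)))"
  by (rule approxI) (use assms in \<open>auto intro: rec_intros rec_fun_tl\<close>)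

lemma approx_none:
  assumes "\<And>xs y. length xs = n \<Longrightarrow> \<not> evalr r xs y"
  shows "approx r n (\<lambda>e. 0)"
  by (rule approxI) (use assms in \<open>auto intro: rec_intros\<close>)

text \<open>One bound \<open>s\<close> is handed to all subcomputations. The value 0 of any
  \<open>T g\<close> means "not yet halted" and must be filtered out before the decrement, which
  would confuse it with the result 0.\<close>

lemma approx_Cn:
  assumes f: "approx f (length gs) t" and g: "\<And>g. g \<in> set gs \<Longrightarrow> approx g n (T g)"
  shows "approx (Cn f gs) n (\<lambda>e. if \<forall>g\<in>set gs. T g e \<noteq> 0
    then t (hd e # map (\<lambda>g. T g e - 1) gs) else 0)" (is "approx _ _ ?t")
proof (rule approxI)
  have "rec_fun (Suc n) (\<lambda>e. t (map (\<lambda>g. g e) (hd # map (\<lambda>g e. T g e - 1) gs)))"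
    by (rule rec_fun_comp) (use approx_rec_fun[OF f] approx_rec_fun[OF g] in
        \<open>auto intro!: rec_intros\<close>)
  then have "rec_fun (Suc n) (\<lambda>e. t (hd e # map (\<lambda>g. T g e - 1) gs))"
    by (simp add: comp_def)
  then have "rec_fun (Suc n) (\<lambda>e. if (if \<forall>t\<in>set (map T gs). t e \<noteq> 0 then 1 else 0) = (0::nat)
      then 0 else t (hd e # map (\<lambda>g. T g e - 1) gs))"
    using approx_rec_fun[OF g] by (intro rec_intros rec_fun_all_nonzero) auto
  then show "rec_fun (Suc n) ?t"
    by (rule rec_fun_cong) auto
next
  fix xs s s' y
  assume len: "length xs = n" and t: "?t (s # xs) = Suc y" and "s \<le> s'"
  have all: "\<forall>g\<in>set gs. T g (s # xs) \<noteq> 0"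
    using t by (auto split: if_splits)
  have eq: "T g (s' # xs) = T g (s # xs)" if "g \<in> set gs" for g
    using all approx_mono[OF g[OF that] len _ \<open>s \<le> s'\<close>] not0_implies_Suc that by metis
  then have eqs: "map (\<lambda>g. T g (s' # xs) - 1) gs = map (\<lambda>g. T g (s # xs) - 1) gs"
    by simp
  have "t (s # map (\<lambda>g. T g (s # xs) - 1) gs) = Suc y"
    using t all by simp
  then have "t (s' # map (\<lambda>g. T g (s' # xs) - 1) gs) = Suc y"
    unfolding eqs using approx_mono[OF f _ _ \<open>s \<le> s'\<close>] by simp
  then show "?t (s' # xs) = Suc y"
    using all eq by simp
next
  fix xs s y
  assume len: "length xs = n" and t: "?t (s # xs) = Suc y"
  have all: "\<forall>g\<in>set gs. T g (s # xs) \<noteq> 0"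
    using t by (auto split: if_splits)
  have "evalr (gs ! i) xs (map (\<lambda>g. T g (s # xs) - 1) gs ! i)" if "i < length gs" for i
    using approx_sound[OF g len, of "gs ! i" s "T (gs ! i) (s # xs) - 1"] all that by simp
  then show "evalr (Cn f gs) xs y"
    using t all by (intro evalr.comp[where ys = "map (\<lambda>g. T g (s # xs) - 1) gs"])
      (auto intro: approx_sound[OF f])
next
  fix xs y
  assume len: "length xs = n" and "evalr (Cn f gs) xs y"
  then obtain ys where ys: "length ys = length gs" "\<forall>i<length gs. evalr (gs ! i) xs (ys ! i)"
    "evalr f ys y"
    by (auto elim: evalr_CnE)
  obtain s0 where s0: "t (s0 # ys) = Suc y"
    using approx_complete[OF f ys(1,3)] by blast
  have "\<forall>i. \<exists>s. i < length gs \<longrightarrow> T (gs ! i) (s # xs) = Suc (ys ! i)"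
    using ys(2) approx_complete[OF g len] by (meson nth_mem)
  then obtain S where S: "\<And>i. i < length gs \<Longrightarrow> T (gs ! i) (S i # xs) = Suc (ys ! i)"
    by metis
  \<comment> \<open>A sum is a convenient common upper bound; monotonicity lifts every
    subcomputation to it.\<close>
  define s where "s = s0 + (\<Sum>i<length gs. S i)"
  have le: "S i \<le> s" if "i < length gs" for i
    using member_le_sum[of i "{..<length gs}" S] that unfolding s_def by simp
  have T: "T (gs ! i) (s # xs) = Suc (ys ! i)" if "i < length gs" for i
    using approx_mono[OF g len S[OF that] le[OF that]] that by simp
  have "map (\<lambda>g. T g (s # xs) - 1) gs = ys"
    using ys(1) T by (intro nth_equalityI) auto
  moreover have "\<forall>g\<in>set gs. T g (s # xs) \<noteq> 0"
    using T by (auto simp: in_set_conv_nth)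
  moreover have "t (s # ys) = Suc y"
    using approx_mono[OF f ys(1) s0, of s] by (simp add: s_def)
  ultimately show "\<exists>s. ?t (s # xs) = Suc y"
    by (intro exI[of _ s]) simp
qed

text \<open>Composition for the case where the new argument list is written with \<open>hd\<close>,
  \<open>tl\<close> and \<open>#\<close> instead of as a \<open>map\<close> over
  projections.\<close>

lemma rec_fun_comp_list:
  assumes "rec_fun m t" "length gs = m" "\<And>g. g \<in> set gs \<Longrightarrow> rec_fun n g"
    and "\<And>xs. length xs = n \<Longrightarrow> map (\<lambda>g. g xs) gs = h xs"
  shows "rec_fun n (\<lambda>e. t (h e))"
proof (rule rec_fun_cong)
  show "rec_fun n (\<lambda>e. t (map (\<lambda>g. g e) gs))"
    using assms by (intro rec_fun_comp) auto
qed (use assms in simp)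

lemma map_nth_tl:
  shows map_nth_tl2: "length xs = Suc (Suc n) \<Longrightarrow>
      map (\<lambda>i. xs ! Suc (Suc i)) [0..<n] = tl (tl xs)"
    and map_nth_tl3: "length xs = Suc (Suc (Suc n)) \<Longrightarrow>
      map (\<lambda>i. xs ! Suc (Suc (Suc i))) [0..<n] = tl (tl (tl xs))"
    and map_nth_tl4: "length xs = Suc (Suc (Suc (Suc n))) \<Longrightarrow>
      map (\<lambda>i. xs ! Suc (Suc (Suc (Suc i)))) [0..<n] = tl (tl (tl (tl xs)))"
  by (auto intro!: nth_equalityI simp: nth_tl)

text \<open>The recursion is run on the encoded values with the bound \<open>s\<close> held fixed; 0
  is absorbing, so one unfinished stage leaves all later stages undefined.\<close>

lemma approx_Pr:
  assumes f: "approx f n t" and g: "approx g (Suc (Suc n)) u"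
  shows "approx (Pr f g) (Suc n) (\<lambda>e. rec_nat (t (hd e # tl (tl e)))
    (\<lambda>i y. if y = 0 then 0 else u (hd e # i # (y - 1) # tl (tl e))) (hd (tl e)))"
    (is "approx _ _ ?t")
proof -
  define F where "F s zs =
      rec_nat (t (s # zs)) (\<lambda>i y. if y = 0 then 0 else u (s # i # (y - 1) # zs))"
    for s zs
  have F_0 [simp]: "F s zs 0 = t (s # zs)"
    and F_Suc [simp]: "F s zs (Suc m) =
      (if F s zs m = 0 then 0 else u (s # m # (F s zs m - 1) # zs))" for s zs m
    by (simp_all add: F_def)
  have t_F: "?t (s # m # zs) = F s zs m" for s m zs
    by (simp only: F_def list.sel)
  have t: "rec_fun (Suc (Suc n)) (\<lambda>e. t (hd e # tl (tl e)))"
    by (rule rec_fun_comp_list[where gs = "[hd] @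
        map (\<lambda>i v. v ! (i + 2)) [0..<n]"])
      (use approx_rec_fun[OF f] in \<open>auto intro!: rec_intros
        simp: comp_def map_nth_tl numeral_eq_Suc\<close>)
  have u: "rec_fun (Suc (Suc (Suc (Suc n)))) (\<lambda>e. u (hd (tl (tl e)) # hd e # (hd (tl e) - 1)
      # tl (tl (tl (tl e)))))"
    by (rule rec_fun_comp_list[where gs = "[\<lambda>v. hd (tl (tl v)), hd, \<lambda>v. hd (tl v) - 1] @
        map (\<lambda>i v. v ! (i + 4)) [0..<n]"])
      (use approx_rec_fun[OF g] in \<open>auto intro!: rec_intros
        simp: comp_def map_nth_tl numeral_eq_Suc\<close>)
  show ?thesis
  proof (rule approxI)
    show "rec_fun (Suc (Suc n)) ?t"
      by (intro rec_intros t u)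
  next
    fix xs s s' y
    assume "length xs = Suc n" and t: "?t (s # xs) = Suc y" and "s \<le> s'"
    then obtain m zs where xs: "xs = m # zs" "length zs = n"
      by (auto simp: length_Suc_conv)
    have "F s zs m = Suc y \<Longrightarrow> F s' zs m = Suc y"
    proof (induction m arbitrary: y)
      case 0
      then show ?case using approx_mono[OF f xs(2) _ \<open>s \<le> s'\<close>] by simp
    next
      case (Suc m)
      then have "F s zs m \<noteq> 0"
        by (auto split: if_splits)
      then obtain w where w: "F s zs m = Suc w"
        using not0_implies_Suc by blast
      with Suc.prems have "u (s # m # w # zs) = Suc y"
        by simp
      then have "u (s' # m # w # zs) = Suc y"
        using approx_mono[OF g _ _ \<open>s \<le> s'\<close>] xs(2) by simp
      then show ?case
        using Suc.IH[OF w] by simp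
    qed
    then show "?t (s' # xs) = Suc y"
      using t unfolding xs(1) t_F by blast
  next
    fix xs s y
    assume "length xs = Suc n" and t: "?t (s # xs) = Suc y"
    then obtain m zs where xs: "xs = m # zs" "length zs = n"
      by (auto simp: length_Suc_conv)
    have "F s zs m = Suc y \<Longrightarrow> evalr (Pr f g) (m # zs) y"
    proof (induction m arbitrary: y)
      case 0
      then show ?case using approx_sound[OF f xs(2)] by (auto intro: evalr.pr0)
    next
      case (Suc m)
      then have "F s zs m \<noteq> 0"
        by (auto split: if_splits)
      then obtain w where w: "F s zs m = Suc w"
        using not0_implies_Suc by blast
      with Suc.prems have "u (s # m # w # zs) = Suc y"
        by simp
      then have "evalr g (m # w # zs) y"
        using approx_sound[OF g] xs(2) by simp
      then show ?case
        using Suc.IH[OF w] by (auto intro: evalr.prS)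
    qed
    then show "evalr (Pr f g) xs y"
      using t unfolding xs(1) t_F by blast
  next
    fix xs y
    assume "length xs = Suc n" and t: "evalr (Pr f g) xs y"
    then obtain m zs where xs: "xs = m # zs" "length zs = n"
      by (auto simp: length_Suc_conv)
    \<comment> \<open>Claiming the value for all sufficiently large bounds, not just one, lets the
      bound of the earlier stages be added to that of the last call of \<open>g\<close>.\<close>
    have "evalr (Pr f g) (m # zs) y \<Longrightarrow> \<exists>s. \<forall>s'\<ge>s. F s' zs m = Suc y"
    proof (induction m arbitrary: y)
      case 0
      then have "evalr f zs y"
        by (auto elim: evalr_Pr0E)
      then obtain s where "t (s # zs) = Suc y"
        using approx_complete[OF f xs(2)] by blast
      then have "\<forall>s'\<ge>s. t (s' # zs) = Suc y"
        using approx_mono[OF f xs(2)] by blast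
      then show ?case
        by auto
    next
      case (Suc m)
      then obtain w where w: "evalr (Pr f g) (m # zs) w" "evalr g (m # w # zs) y"
        by (auto elim: evalr_PrSE)
      obtain s where s: "\<And>s'. s \<le> s' \<Longrightarrow> F s' zs m = Suc w"
        using Suc.IH[OF w(1)] by blast
      obtain s1 where "u (s1 # m # w # zs) = Suc y"
        using approx_complete[OF g _ w(2)] xs(2) by auto
      then have "u (s' # m # w # zs) = Suc y" if "s1 \<le> s'" for s'
        using approx_mono[OF g _ _ that] xs(2) by simp
      then have "\<forall>s'\<ge>s + s1. F s' zs (Suc m) = Suc y"
        using s by simp
      then show ?case ..
    qed
    then show "\<exists>s. ?t (s # xs) = Suc y"
      using t unfolding xs(1) t_F by blast
  qed
qed

lemma sum_nat_eq_single:
  fixes f :: "nat \<Rightarrow> nat"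
  assumes "i < s" "\<And>j. j < s \<Longrightarrow> j \<noteq> i \<Longrightarrow> f j = 0"
  shows "sum f {..<s} = f i"
  using assms by (subst sum.remove[of _ i]) auto

text \<open>In the encoding, \<open>t = 1\<close> means halted with value 0, and
  \<open>2 - t = 0\<close> means halted with a positive value. So a summand is nonzero only if
  \<open>m\<close> is a zero of \<open>f\<close> and all smaller arguments are known to be nonzeros.
  At most one \<open>m\<close> qualifies, and the sum equals its encoded value
  \<open>Suc m\<close>.\<close>

lemma approx_Mn:
  assumes f: "approx f (Suc n) t"
  shows "approx (Mn f) n (\<lambda>e. \<Sum>m<hd e. if t (hd e # m # tl e) = 1
    then if (\<Sum>i<m. 2 - t (hd e # i # tl e)) = 0 then Suc m else 0 else 0)"
    (is "approx _ _ ?t")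
proof (rule approxI)
  have t: "rec_fun (Suc (Suc n)) (\<lambda>e. t (hd (tl e) # hd e # tl (tl e)))"
    by (rule rec_fun_comp_list[where gs = "[\<lambda>v. hd (tl v), hd] @
        map (\<lambda>i v. v ! (i + 2)) [0..<n]"])
      (use approx_rec_fun[OF f] in \<open>auto intro!: rec_intros
        simp: comp_def map_nth_tl numeral_eq_Suc\<close>)
  have u: "rec_fun (Suc (Suc (Suc n))) (\<lambda>e. t (hd (tl (tl e)) # hd e # tl (tl (tl e))))"
    by (rule rec_fun_comp_list[where gs = "[\<lambda>v. hd (tl (tl v)), hd] @
        map (\<lambda>i v. v ! (i + 3)) [0..<n]"])
      (use approx_rec_fun[OF f] in \<open>auto intro!: rec_intros
        simp: comp_def map_nth_tl numeral_eq_Suc\<close>)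
  show "rec_fun (Suc n) ?t"
    by (intro rec_intros t u)
next
  have *: "?t (s # xs) = Suc m \<longleftrightarrow> m < s \<and> t (s # m # xs) = 1 \<and> (\<forall>i<m. t (s # i # xs) \<ge> 2)"
    (is "_ \<longleftrightarrow> ?P m") for s xs m
  proof -
    have t: "?t (s # xs) = (\<Sum>m<s. if ?P m then Suc m else 0)"
      unfolding list.sel by (intro sum.cong refl) (auto simp: diff_is_0_eq)
    have sum: "(\<Sum>m<s. if ?P m then Suc m else 0) = Suc j" if "?P j" for j
    proof -
      have "(\<Sum>m<s. if ?P m then Suc m else 0) = (if ?P j then Suc j else 0)"
      proof (rule sum_nat_eq_single)
        show "(if ?P i then Suc i else 0) = 0" if "i \<noteq> j" for i
          using \<open>?P j\<close> that by (cases i j rule: linorder_cases) auto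
      qed (use that in blast)
      then show ?thesis using that by presburger
    qed
    show ?thesis
    proof (cases "\<exists>j. ?P j")
      case True
      then obtain j where j: "?P j" by blast
      show ?thesis
      proof
        assume "?t (s # xs) = Suc m"
        then have "m = j"
          using sum[OF j] t by simp
        then show "?P m" using j by simp
      next
        assume "?P m"
        then show "?t (s # xs) = Suc m"
          using sum t by simp
      qed
    next
      case False
      then have "(\<Sum>m<s. if ?P m then Suc m else 0) = 0"
        by (intro sum.neutral) auto
      then show ?thesis
        using False t by simp
    qed
  qed
  have mono0: "t (s' # i # xs) = t (s # i # xs)"
    if len: "length xs = n" and le: "s \<le> s'" and nz: "t (s # i # xs) \<noteq> 0" for xs s s' i
  proof -
    obtain y where "t (s # i # xs) = Suc y"
      using nz not0_implies_Suc by blast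
    then show ?thesis
      using approx_mono[OF f, of "i # xs" s y s'] len le by simp
  qed
  show "?t (s' # xs) = Suc y"
    if len: "length xs = n" and t: "?t (s # xs) = Suc y" and le: "s \<le> s'" for xs s s' y
  proof -
    have P: "y < s" "t (s # y # xs) = 1" "\<forall>i<y. t (s # i # xs) \<ge> 2"
      using t unfolding * by blast+
    have "t (s' # y # xs) = 1"
      using mono0[OF len le, of y] P(2) by simp
    moreover have "t (s' # i # xs) \<ge> 2" if "i < y" for i
    proof -
      have "t (s # i # xs) \<ge> 2"
        using P(3) that by blast
      then show ?thesis
        using mono0[OF len le, of i] by simp
    qed
    ultimately show ?thesis
      unfolding * using P(1) le by simp
  qed
  show "evalr (Mn f) xs y" if len: "length xs = n" and t: "?t (s # xs) = Suc y" for xs s y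
  proof (rule evalr.mn)
    show "evalr f (y # xs) 0"
      using t len unfolding * by (intro approx_sound[OF f]) auto
    show "\<forall>m<y. \<exists>z. evalr f (m # xs) (Suc z)"
    proof (intro allI impI)
      fix m assume "m < y"
      then have "t (s # m # xs) = Suc (Suc (t (s # m # xs) - 2))"
        using t unfolding * by fastforce
      then show "\<exists>z. evalr f (m # xs) (Suc z)"
        using approx_sound[OF f, of "m # xs"] len by fastforce
    qed
  qed
  show "\<exists>s. ?t (s # xs) = Suc y" if len: "length xs = n" and ev: "evalr (Mn f) xs y" for xs y
  proof -
    from ev have 0: "evalr f (y # xs) 0" and S: "\<forall>m<y. \<exists>z. evalr f (m # xs) (Suc z)"
      by (auto elim: evalr_MnE)
    obtain s0 where s0: "t (s0 # y # xs) = Suc 0"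
      using approx_complete[OF f _ 0] len by auto
    have "\<forall>m. \<exists>s. m < y \<longrightarrow> t (s # m # xs) \<ge> 2"
    proof
      fix m
      show "\<exists>s. m < y \<longrightarrow> t (s # m # xs) \<ge> 2"
      proof (cases "m < y")
        case True
        then obtain z where "evalr f (m # xs) (Suc z)"
          using S by blast
        then obtain s where "t (s # m # xs) = Suc (Suc z)"
          using approx_complete[OF f, of "m # xs"] len by auto
        then show ?thesis
          by (intro exI[of _ s]) simp
      qed simp
    qed
    then obtain S where S: "\<And>m. m < y \<Longrightarrow> t (S m # m # xs) \<ge> 2"
      by metis
    \<comment> \<open>The bound also limits the candidates searched, so it has to exceed
      \<open>y\<close> itself; hence the last summand.\<close>
    define s where "s = s0 + (\<Sum>m<y. S m) + Suc y"
    have "S m \<le> s" if "m < y" for m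
      using member_le_sum[of m "{..<y}" S] that unfolding s_def by simp
    then have "t (s # m # xs) \<ge> 2" if "m < y" for m
      using mono0[OF len, of "S m" s m] S[OF that] that by simp
    moreover have "t (s # y # xs) = 1"
      using mono0[OF len, of s0 s y] s0 by (simp add: s_def)
    moreover have "y < s"
      by (simp add: s_def)
    ultimately have "?t (s # xs) = Suc y"
      unfolding * by blast
    then show ?thesis ..
  qed
qed

text \<open>The induction covers all arities at once, since \<open>Cn\<close>, \<open>Pr\<close> and
  \<open>Mn\<close> change them. Where a function never halts because an argument is missing, the
  approximation is constantly 0. As values persist when the bound grows, this also shows that
  \<open>evalr\<close> is single-valued.\<close>

theorem approx_exists: "\<exists>t. approx r n t"
proof (induction r arbitrary: n)
  case Zf
  have "approx Zf n (\<lambda>e. Suc ((\<lambda>e. 0) (tl e)))"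
    by (rule approx_total) (auto intro: rec_intros evalr.zero elim: evalr_ZfE)
  then show ?case by blast
next
  case Sf
  show ?case
  proof (cases n)
    case 0
    then have "approx Sf n (\<lambda>e. 0)"
      by (intro approx_none) (auto elim: evalr_SfE)
    then show ?thesis by blast
  next
    case (Suc m)
    then have "approx Sf n (\<lambda>e. Suc ((\<lambda>e. Suc (hd e)) (tl e)))"
      by (intro approx_total)
        (auto intro: rec_intros evalr.suc elim: evalr_SfE simp: length_Suc_conv)
    then show ?thesis by blast
  qed
next
  case (Idf i)
  show ?case
  proof (cases "i < n")
    case False
    then have "approx (Idf i) n (\<lambda>e. 0)"
      by (intro approx_none) (auto elim: evalr_IdfE)
    then show ?thesis by blast
  next
    case True
    then have "approx (Idf i) n (\<lambda>e. Suc ((\<lambda>e. e ! i) (tl e)))"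
      by (intro approx_total) (auto intro: rec_intros evalr.ident elim: evalr_IdfE)
    then show ?thesis by blast
  qed
next
  case (Cn f gs)
  obtain t where t: "approx f (length gs) t"
    using Cn.IH(1) by blast
  have "\<forall>g\<in>set gs. \<exists>t. approx g n t"
    using Cn.IH(2) by blast
  then obtain T where T: "\<And>g. g \<in> set gs \<Longrightarrow> approx g n (T g)"
    by metis
  show ?case
    by (rule exI, rule approx_Cn[OF t]) (rule T)
next
  case (Pr f g)
  show ?case
  proof (cases n)
    case 0
    then have "approx (Pr f g) n (\<lambda>e. 0)"
      by (intro approx_none) (auto elim: evalr_PrNilE)
    then show ?thesis by blast
  next
    case (Suc m)
    obtain t u where tu: "approx f m t" "approx g (Suc (Suc m)) u"
      using Pr.IH by blast
    show ?thesis
      unfolding Suc by (rule exI, rule approx_Pr[OF tu])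
  qed
next
  case (Mn f)
  then obtain t where t: "approx f (Suc n) t"
    by blast
  show ?case
    by (rule exI, rule approx_Mn[OF t])
qed

section \<open>Codes of words\<close>

text \<open>Unbounded minimization halts exactly when a witness exists.\<close>

lemma ce_set_Collect_ex:
  assumes "rec_fun 2 (\<lambda>e. p (e ! 0) (e ! 1))"
  shows "ce_set {x. \<exists>m. p m x = 0}"
proof -
  obtain r where r: "\<And>xs. length xs = 2 \<Longrightarrow> evalr r xs (p (xs ! 0) (xs ! 1))"
    using assms unfolding rec_fun_def by blast
  have "(\<exists>m. p m x = 0) \<longleftrightarrow> (\<exists>y. evalr (Mn r) [x] y)" for x
  proof
    assume ex: "\<exists>m. p m x = 0"
    have "evalr (Mn r) [x] (LEAST m. p m x = 0)" (is "evalr _ _ ?m")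
    proof (rule evalr.mn)
      show "evalr r [?m, x] 0"
        using r[of "[?m, x]"] LeastI_ex[OF ex] by simp
      show "\<forall>m<?m. \<exists>y. evalr r [m, x] (Suc y)"
      proof (intro allI impI)
        fix m assume "m < ?m"
        then have "p m x \<noteq> 0"
          by (rule not_less_Least)
        then show "\<exists>y. evalr r [m, x] (Suc y)"
          using r[of "[m, x]"] by (cases "p m x") auto
      qed
    qed
    then show "\<exists>y. evalr (Mn r) [x] y" ..
  next
    assume "\<exists>y. evalr (Mn r) [x] y"
    then obtain m where m: "evalr r [m, x] 0"
      by (auto elim: evalr_MnE)
    \<comment> \<open>The values 0 and \<open>p m x\<close> of \<open>r\<close> at the same
      arguments must agree: both are read off an approximation at a common bound.\<close>
    obtain t where t: "approx r 2 t"
      using approx_exists by blast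
    have "evalr r [m, x] (p m x)"
      using r[of "[m, x]"] by simp
    then obtain s s' where s: "t [s, m, x] = Suc 0" "t [s', m, x] = Suc (p m x)"
      using m approx_complete[OF t, of "[m, x]"] by fastforce
    have "t [max s s', m, x] = Suc 0" "t [max s s', m, x] = Suc (p m x)"
      using approx_mono[OF t _ s(1), of "max s s'"] approx_mono[OF t _ s(2), of "max s s'"]
      by simp_all
    then show "\<exists>m. p m x = 0"
      by (intro exI[of _ m]) simp
  qed
  then show ?thesis
    unfolding ce_set_def by blast
qed

text \<open>Words are enumerated by the base \<open>2 * k + 1\<close> digits of a number, where the digit 0 is
  skipped, so that every number is a code and all words of length at most \<open>n\<close> arise from the
  lowest \<open>n\<close> digits.\<close>

definition digit_letter :: "nat \<Rightarrow> letter" where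
  "digit_letter d = ((d - 1) div 2, (d - 1) mod 2 = 1)"

definition digit_word :: "nat \<Rightarrow> letter list" where
  "digit_word d = (if d = 0 then [] else [digit_letter d])"

definition digit :: "nat \<Rightarrow> nat \<Rightarrow> nat \<Rightarrow> nat" where
  "digit k i c = c div (2 * k + 1) ^ i mod (2 * k + 1)"

fun digit_words :: "nat \<Rightarrow> nat \<Rightarrow> nat \<Rightarrow> letter list" where
  "digit_words k 0 c = []"
| "digit_words k (Suc i) c = digit_word (digit k i c) @ digit_words k i c"

lemma length_digit_words: "length (digit_words k i c) \<le> i"
  by (induction i) (auto simp: digit_word_def)

lemma digit_less: "digit k i c < 2 * k + 1"
  by (simp add: digit_def)

lemma fst_digit_words: "a \<in> set (digit_words k i c) \<Longrightarrow> fst a < k"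
proof (induction i)
  case (Suc i)
  then show ?case
    using digit_less[of k i c] by (auto simp: digit_word_def digit_letter_def split: if_splits)
qed simp

text \<open>The additional digits are leading zeros, and the digit 0 contributes no letter.\<close>

lemma digit_words_extend:
  assumes "c < (2 * k + 1) ^ i" "i \<le> j"
  shows "digit_words k j c = digit_words k i c"
  using assms(2)
proof (induction j rule: dec_induct)
  case (step j)
  have "(2 * k + 1) ^ i \<le> (2 * k + 1) ^ j"
    using step by (intro power_increasing) auto
  then have "c < (2 * k + 1) ^ j"
    using assms(1) by simp
  then have "digit k j c = 0"
    unfolding digit_def by simp
  then show ?case
    using step by (simp add: digit_word_def)
qed simp

lemma digit_words_cong:
  assumes "\<And>j. j < i \<Longrightarrow> digit k j c = digit k j c'"
  shows "digit_words k i c = digit_words k i c'"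
  using assms by (induction i) auto

lemma digit_words_surj:
  assumes "\<And>a. a \<in> set l \<Longrightarrow> fst a < k"
  shows "\<exists>c < (2 * k + 1) ^ length l. digit_words k (length l) c = l"
  using assms
proof (induction l)
  case (Cons a l)
  define K n where "K = 2 * k + 1" and "n = length l"
  obtain c where c: "c < K ^ n" "digit_words k n c = l"
    using Cons unfolding K_def n_def by auto
  define d where "d = Suc (2 * fst a + (if snd a then 1 else 0))"
  have "fst a < k"
    using Cons.prems by simp
  then have d: "d < K" "digit_word d = [a]"
    by (auto simp: d_def K_def digit_word_def digit_letter_def prod_eq_iff)
  define c' where "c' = d * K ^ n + c"
  have K: "K > 0"
    by (simp add: K_def)
  have "digit k j c' = digit k j c" if "j < n" for j
  proof -
    have "K ^ n = K ^ j * (K * K ^ (n - j - 1))"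
      using that by (simp flip: power_add power_Suc)
    then have "c' = (d * K ^ (n - j - 1) * K) * K ^ j + c"
      by (simp add: c'_def algebra_simps)
    then have "c' div K ^ j = (d * K ^ (n - j - 1)) * K + c div K ^ j"
      using K by simp
    then show ?thesis
      unfolding digit_def K_def[symmetric] by simp
  qed
  then have "digit_words k n c' = l"
    using digit_words_cong[of n k c' c] c(2) by simp
  moreover have "digit k n c' = d"
    unfolding digit_def K_def[symmetric] c'_def using c(1) d(1) K by simp
  moreover have "c' < K ^ Suc n"
  proof -
    have "c' < d * K ^ n + K ^ n"
      using c(1) by (simp add: c'_def)
    also have "\<dots> = Suc d * K ^ n"
      by simp
    also have "\<dots> \<le> K * K ^ n"
      using d(1) by (intro mult_right_mono) auto
    finally show ?thesis by simp
  qed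
  ultimately show ?case
    using d(2) by (intro exI[of _ c']) (simp add: K_def n_def)
qed simp

text \<open>A number can serve as its own digit count, because \<open>c < 2 ^ c\<close> and the base
  is at least 2; thus a single number names a word of any length. For \<open>k = 0\<close> the base
  is 1, and only the empty word occurs.\<close>

lemma digit_words_surj_self:
  assumes "\<And>a. a \<in> set l \<Longrightarrow> fst a < k"
  shows "\<exists>c. digit_words k c c = l"
proof (cases "k = 0")
  case True
  then have "l = []"
    using assms by (cases l) auto
  then show ?thesis
    by (intro exI[of _ 0]) simp
next
  case False
  obtain c where c: "c < (2 * k + 1) ^ length l" "digit_words k (length l) c = l"
    using digit_words_surj[OF assms] by blast
  have "c < 2 ^ c" by (rule less_exp)
  also have "2 ^ c \<le> (2 * k + 1) ^ c"
    using False by (intro power_mono) auto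
  finally have "digit_words k c c = digit_words k (length l) c"
    using digit_words_extend[OF c(1)] digit_words_extend[of c k c "length l"]
    by (metis linear)
  then show ?thesis
    using c(2) by metis
qed

section \<open>The group operation on codes of words\<close>

definition letter_code :: "letter \<Rightarrow> nat" where
  "letter_code a = prod_encode (fst a, if snd a then 1 else 0)"

lemma code_Nil [simp]: "code [] = 0"
  by (simp add: code_def)

lemma code_Cons: "code (a # w) = Suc (prod_encode (letter_code a, code w))"
  by (cases a) (simp add: code_def letter_code_def)

lemma letter_code_inject: "letter_code a = letter_code b \<longleftrightarrow> a = b"
  by (auto simp: letter_code_def prod_eq_iff)

lemma inj_code: "inj code"
proof (rule injI)
  show "code v = code w \<Longrightarrow> v = w" for v w
  proof (induction v arbitrary: w)
    case Nil
    then show ?case by (cases w) (auto simp: code_Cons)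
  next
    case (Cons a v)
    then show ?case by (cases w) (auto simp: code_Cons letter_code_inject)
  qed
qed

text \<open>Makes the code a computable upper bound for the length of a word in \<Gamma>.\<close>

lemma length_le_code: "length w \<le> code w"
proof (induction w)
  case (Cons a w)
  then show ?case
    using le_prod_encode_2[of "code w" "letter_code a"] by (simp add: code_Cons)
qed simp

text \<open>The letter is given by its digit, with 0 for no letter. \<open>x - 1\<close> strips the
  \<open>Suc\<close> from the code of a nonempty word, leaving the pair of head and tail;
  \<open>1 - (d - 1) mod 2\<close> is the sign of the inverse letter.\<close>

definition push_code :: "nat \<Rightarrow> nat \<Rightarrow> nat" where
  "push_code d x = (if d = 0 then x
    else if x = 0 then Suc (prod_encode (prod_encode ((d - 1) div 2, (d - 1) mod 2), x))
    else if pfst (x - 1) = prod_encode ((d - 1) div 2, 1 - (d - 1) mod 2) then psnd (x - 1)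
    else Suc (prod_encode (prod_encode ((d - 1) div 2, (d - 1) mod 2), x)))"

lemma rec_fun_push_code [rec_intros]:
  assumes "rec_fun n a" "rec_fun n b"
  shows "rec_fun n (\<lambda>e. push_code (a e) (b e))"
  unfolding push_code_def by (intro rec_intros assms)

lemma push_code: "push_code d (code w) = code (fmult (digit_word d) w)"
proof (cases "d = 0")
  case True
  then show ?thesis by (simp add: push_code_def digit_word_def fmult_def)
next
  case False
  have 1: "letter_code (digit_letter d) = prod_encode ((d - 1) div 2, (d - 1) mod 2)"
    by (auto simp: letter_code_def digit_letter_def)
  have 2: "cancels (digit_letter d) b \<longleftrightarrow>
      letter_code b = prod_encode ((d - 1) div 2, 1 - (d - 1) mod 2)" for b
    by (auto simp: letter_code_def digit_letter_def cancels_def)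
  show ?thesis
  proof (cases w)
    case Nil
    then show ?thesis
      using False 1 by (simp add: push_code_def digit_word_def fmult_def code_Cons)
  next
    case (Cons b u)
    then show ?thesis
      using False 1 2[of b] by (simp add: push_code_def digit_word_def fmult_def code_Cons)
  qed
qed

text \<open>The digit of index 0 is the last letter, so primitive recursion on the index pushes
  letters from right to left, as \<open>fmult\<close> does.\<close>

definition mult_code :: "nat \<Rightarrow> nat \<Rightarrow> nat \<Rightarrow> nat \<Rightarrow> nat" where
  "mult_code k i c x = rec_nat x (\<lambda>j y. push_code (digit k j c) y) i"

lemma rec_fun_mult_code [rec_intros]:
  assumes "rec_fun n a" "rec_fun n b" "rec_fun n c"
  shows "rec_fun n (\<lambda>e. mult_code k (a e) (b e) (c e))"
  unfolding mult_code_def digit_def by (intro rec_intros rec_fun_tl assms)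

lemma mult_code: "mult_code k i c (code w) = code (fmult (digit_words k i c) w)"
  by (induction i) (auto simp: mult_code_def push_code fmult_def)

section \<open>Free groups and generic sets\<close>

definition flip :: "letter \<Rightarrow> letter" where
  "flip a = (fst a, \<not> snd a)"

definition inv_word :: "letter list \<Rightarrow> letter list" where
  "inv_word w = rev (map flip w)"

lemma flip_flip [simp]: "flip (flip a) = a"
  by (simp add: flip_def)

lemma fst_flip [simp]: "fst (flip a) = fst a"
  by (simp add: flip_def)

lemma cancels_iff_flip: "cancels a b \<longleftrightarrow> b = flip a"
  by (auto simp: cancels_def flip_def prod_eq_iff)

lemma length_inv_word [simp]: "length (inv_word w) = length w"
  by (simp add: inv_word_def)

lemma inv_word_inv_word [simp]: "inv_word (inv_word w) = w"
  by (simp add: inv_word_def rev_map comp_def)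

lemma fst_inv_word: "a \<in> set (inv_word w) \<Longrightarrow> \<exists>b\<in>set w. fst a = fst b"
  by (force simp: inv_word_def)

lemma reduced_tl: "reduced (a # w) \<Longrightarrow> reduced w"
  by (cases w) auto

lemma reduced_Cons_iff: "reduced (a # w) \<longleftrightarrow> reduced w \<and> (w = [] \<or> \<not> cancels a (hd w))"
  by (cases w) auto

lemma reduced_append: "reduced (u @ v) \<Longrightarrow> reduced u \<and> reduced v"
  by (induction u) (auto simp: reduced_Cons_iff)

lemma reduced_push: "reduced w \<Longrightarrow> reduced (push a w)"
  by (cases w) (auto dest: reduced_tl)

text \<open>If \<open>w\<close> starts with \<open>flip a\<close>, then \<open>push a\<close>
  deletes that letter; pushing it back restores \<open>w\<close> because, by reducedness, the
  remaining word does not start with \<open>a\<close>.\<close>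

lemma push_flip_push: "reduced w \<Longrightarrow> push (flip a) (push a w) = w"
proof (cases w)
  case (Cons b u)
  assume "reduced w"
  then show ?thesis
    using Cons by (cases u) (auto simp: cancels_iff_flip)
qed (simp add: cancels_iff_flip)

lemma set_push: "set (push a w) \<subseteq> insert a (set w)"
  by (cases w) auto

lemma length_push: "length (push a w) \<le> Suc (length w)"
  by (cases w) auto

lemma fmult_Nil [simp]: "fmult [] w = w"
  by (simp add: fmult_def)

lemma fmult_Cons [simp]: "fmult (a # u) w = push a (fmult u w)"
  by (simp add: fmult_def)

lemma fmult_append: "fmult (u @ v) w = fmult u (fmult v w)"
  by (induction u) auto

lemma reduced_fmult: "reduced w \<Longrightarrow> reduced (fmult u w)"
  by (induction u) (auto intro: reduced_push)

lemma set_fmult: "set (fmult u w) \<subseteq> set u \<union> set w"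
  by (induction u) (use set_push in fastforce)+

lemma length_fmult: "length (fmult u w) \<le> length u + length w"
proof (induction u)
  case (Cons a u)
  then show ?case
    using length_push[of a "fmult u w"] by simp
qed simp

lemma fmult_push:
  assumes "reduced w"
  shows "fmult (push a u) w = push a (fmult u w)"
proof (cases u)
  case (Cons b v)
  then show ?thesis
    using push_flip_push[OF reduced_fmult[OF assms, of v], of b]
    by (auto simp: cancels_iff_flip)
qed simp

text \<open>Letters act by \<open>push\<close> as permutations of the reduced words, with
  \<open>a\<close> and \<open>flip a\<close> acting inversely. Free cancellation in the left factor
  therefore leaves its action on \<open>w\<close> unchanged.\<close>

lemma fmult_assoc: "reduced w \<Longrightarrow> fmult (fmult u v) w = fmult u (fmult v w)"
  by (induction u) (auto simp: fmult_push)

lemma fmult_Nil_right: "reduced u \<Longrightarrow> fmult u [] = u"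
proof (induction u)
  case (Cons a u)
  then show ?case
    using reduced_tl[of a u] by (cases u) auto
qed simp

lemma fmult_inv_left: "reduced w \<Longrightarrow> fmult (inv_word u) (fmult u w) = w"
proof (induction u)
  case (Cons a u)
  then show ?case
    by (simp add: inv_word_def fmult_append push_flip_push reduced_fmult)
qed (simp add: inv_word_def)

lemma fmult_inv_right: "reduced w \<Longrightarrow> fmult u (fmult (inv_word u) w) = w"
  using fmult_inv_left[of w "inv_word u"] by simp

lemma FX_reduced: "w \<in> FX k \<Longrightarrow> reduced w"
  by (simp add: FX_def)

lemma FX_fst: "w \<in> FX k \<Longrightarrow> a \<in> set w \<Longrightarrow> fst a < k"
  by (simp add: FX_def)

lemma Nil_in_FX [simp]: "[] \<in> FX k"
  by (simp add: FX_def)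

lemma fmult_in_FX:
  assumes "\<And>a. a \<in> set u \<Longrightarrow> fst a < k" "w \<in> FX k"
  shows "fmult u w \<in> FX k"
  using assms set_fmult[of u w] reduced_fmult[of w u] unfolding FX_def by auto

lemma fmult_FX: "u \<in> FX k \<Longrightarrow> w \<in> FX k \<Longrightarrow> fmult u w \<in> FX k"
  using fmult_in_FX FX_fst by blast

text \<open>Multiplying onto the empty word normalizes \<open>inv_word u\<close>, so this product is
  used as the inverse in \<open>FX k\<close>.\<close>

lemma inv_in_FX:
  assumes "u \<in> FX k"
  shows "fmult (inv_word u) [] \<in> FX k"
proof (rule fmult_in_FX)
  show "fst a < k" if "a \<in> set (inv_word u)" for a
    using fst_inv_word[OF that] FX_fst[OF assms] by auto
qed simp

lemma inj_on_fmult: "inj_on (fmult u) (FX k)"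
  by (rule inj_on_inverseI[of _ "fmult (inv_word u)"]) (simp add: FX_reduced fmult_inv_left)

lemma Ball_FX: "w \<in> Ball k n \<Longrightarrow> w \<in> FX k"
  by (simp add: Ball_def)

lemma Ball_length: "w \<in> Ball k n \<Longrightarrow> length w \<le> n"
  by (simp add: Ball_def)

lemma Nil_in_Ball [simp]: "[] \<in> Ball k n"
  by (simp add: Ball_def)

lemma Ball_mono: "m \<le> n \<Longrightarrow> Ball k m \<subseteq> Ball k n"
  by (auto simp: Ball_def)

lemma finite_Ball: "finite (Ball k n)"
proof (rule finite_subset)
  show "Ball k n \<subseteq> {w. set w \<subseteq> {..<k} \<times> UNIV \<and> length w \<le> n}"
    by (auto simp: Ball_def FX_def)
  show "finite {w. set w \<subseteq> {..<k} \<times> (UNIV :: bool set) \<and> length w \<le> n}"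
    by (rule finite_lists_length_le) simp
qed

lemma card_Ball_pos: "card (Ball k n) > 0"
  using finite_Ball[of k n] Nil_in_Ball[of k n] card_gt_0_iff by blast

lemma fmult_in_Ball:
  assumes "u \<in> Ball k m" "w \<in> Ball k n"
  shows "fmult u w \<in> Ball k (m + n)"
  using assms length_fmult[of u w] fmult_FX[of u k w] unfolding Ball_def by auto

lemma inv_in_Ball: "u \<in> Ball k n \<Longrightarrow> fmult (inv_word u) [] \<in> Ball k n"
  using inv_in_FX[of u k] length_fmult[of "inv_word u" "[]"] unfolding Ball_def by auto

lemma Ball_split:
  assumes "u \<in> Ball k (m + n)"
  obtains v w where "v \<in> Ball k m" "w \<in> Ball k n" "u = fmult v w"
proof
  have red: "reduced (take m u)" "reduced (drop m u)"
    using reduced_append[of "take m u" "drop m u"] assms by (auto simp: Ball_def FX_def)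
  show "take m u \<in> Ball k m" "drop m u \<in> Ball k n"
    using assms red by (auto simp: Ball_def FX_def dest: in_set_takeD in_set_dropD)
  have "fmult (take m u) (drop m u) = fmult (take m u @ drop m u) []"
    using red by (simp only: fmult_append fmult_Nil_right)
  then show "u = fmult (take m u) (drop m u)"
    using assms by (simp add: fmult_Nil_right Ball_def FX_def)
qed

section \<open>Density of a set in translates of balls\<close>

lemma card_Int_translate_le: "card (S \<inter> fmult w ` Ball k n) \<le> card (Ball k n)"
proof -
  have "card (S \<inter> fmult w ` Ball k n) \<le> card (fmult w ` Ball k n)"
    by (rule card_mono) (auto simp: finite_Ball)
  also have "\<dots> \<le> card (Ball k n)"
    by (rule card_image_le[OF finite_Ball])
  finally show ?thesis .
qed

text \<open>The maximum in \<open>UB_generic\<close> is over all centres, in general infinitely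
  many, but the counts are bounded by the size of the ball, so \<open>Max\<close> is a genuine
  maximum.\<close>

lemma finite_card_translates: "finite ((\<lambda>w. card (S \<inter> fmult w ` Ball k n)) ` FX k)"
  by (rule finite_subset[of _ "{..card (Ball k n)}"]) (auto simp: card_Int_translate_le)

text \<open>A point of \<open>Y\<close> has the form w v t with v in the \<open>m\<close>-ball and t
  in the \<open>n\<close>-ball. Near w v there is a point y = w v u outside \<open>S\<close>, still
  in \<open>Y\<close>, and the given point is y u^(-1) t. Hence y, u and t determine it, and each y
  outside \<open>S\<close> accounts for at most |B_n|^2 points.\<close>

lemma card_translate_Diff:
  fixes m :: nat
  assumes bad: "\<And>v. v \<in> FX k \<Longrightarrow> \<exists>u\<in>Ball k n. fmult v u \<notin> S" and "w \<in> FX k"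
  defines "Y \<equiv> fmult w ` Ball k (m + n)"
  shows "card Y \<le> card (Y - S) * (card (Ball k n))\<^sup>2"
proof -
  let ?h = "\<lambda>(y, u, t). fmult (fmult y (fmult (inv_word u) [])) t"
  have "Y \<subseteq> ?h ` ((Y - S) \<times> Ball k n \<times> Ball k n)"
  proof
    fix x assume "x \<in> Y"
    then obtain z where z: "z \<in> Ball k (m + n)" "x = fmult w z"
      unfolding Y_def by blast
    from z(1) obtain v t where vt: "v \<in> Ball k m" "t \<in> Ball k n" "z = fmult v t"
      by (rule Ball_split)
    have wv: "fmult w v \<in> FX k"
      using \<open>w \<in> FX k\<close> Ball_FX[OF vt(1)] by (rule fmult_FX)
    then obtain u where u: "u \<in> Ball k n" "fmult (fmult w v) u \<notin> S"
      using bad by blast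
    define y where "y = fmult (fmult w v) u"
    have red: "reduced u" "reduced t" "reduced (fmult w v)"
      using u(1) vt(2) wv by (auto dest: Ball_FX FX_reduced)
    have "y = fmult w (fmult v u)"
      unfolding y_def using red(1) by (rule fmult_assoc)
    then have y: "y \<in> Y - S"
      using u fmult_in_Ball[OF vt(1) u(1)] y_def by (auto simp: Y_def)
    have "fmult y (fmult (inv_word u) []) = fmult (fmult w v) (fmult u (fmult (inv_word u) []))"
      unfolding y_def by (rule fmult_assoc) (simp add: reduced_fmult)
    also have "\<dots> = fmult w v"
      using red(3) by (simp add: fmult_inv_right fmult_Nil_right)
    finally have "?h (y, u, t) = x"
      using red(2) z(2) vt(3) by (simp add: fmult_assoc)
    then show "x \<in> ?h ` ((Y - S) \<times> Ball k n \<times> Ball k n)"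
      using y u(1) vt(2) by (metis (no_types, lifting) SigmaI image_eqI)
  qed
  moreover have "finite ((Y - S) \<times> Ball k n \<times> Ball k n)"
    unfolding Y_def by (simp add: finite_Ball)
  ultimately have "card Y \<le> card ((Y - S) \<times> Ball k n \<times> Ball k n)"
    by (meson surj_card_le)
  then show ?thesis
    by (simp add: card_cartesian_product power2_eq_square)
qed

text \<open>If no translate of the \<open>n\<close>-ball lay in \<open>S\<close>, then every point of a larger ball would be within
  distance \<open>2 * n\<close> of a point of that ball outside \<open>S\<close>, so the density of \<open>S\<close> would stay
  bounded away from 1.\<close>

lemma UB_generic_contains_translate:
  assumes "UB_generic k S"
  shows "\<exists>v\<in>FX k. fmult v ` Ball k n \<subseteq> S"
proof (rule ccontr)
  assume "\<not> ?thesis"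
  then have bad: "\<And>v. v \<in> FX k \<Longrightarrow> \<exists>u\<in>Ball k n. fmult v u \<notin> S"
    by blast
  \<comment> \<open>At least one point in \<open>b\<close> of every large translate is missing from
    \<open>S\<close>, which gives the density bound 1 - 1/b.\<close>
  define b where "b = real ((card (Ball k n))\<^sup>2)"
  have b: "b \<ge> 1"
    using card_Ball_pos[of k n] unfolding b_def by (simp add: Suc_le_eq)
  have bound: "card (S \<inter> fmult w ` Ball k m) \<le> (1 - 1 / b) * card (Ball k m)"
    if "n \<le> m" "w \<in> FX k" for m w
  proof -
    define Y where "Y = fmult w ` Ball k m"
    have fin: "finite Y"
      by (simp add: Y_def finite_Ball)
    have "card Y \<le> card (Y - S) * (card (Ball k n))\<^sup>2"
      using card_translate_Diff[OF bad \<open>w \<in> FX k\<close>, of "m - n"] \<open>n \<le> m\<close> by (simp add: Y_def)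
    then have "real (card Y) \<le> card (Y - S) * b"
      unfolding b_def by (metis of_nat_mono of_nat_mult)
    then have "real (card Y) / b \<le> card (Y - S)"
      using b by (simp add: field_simps)
    moreover have "card Y = card (S \<inter> Y) + card (Y - S)"
      using card_Int_Diff[OF fin, of S] by (simp add: Int_commute)
    ultimately have "real (card (S \<inter> Y)) \<le> (1 - 1 / b) * card Y"
      by (simp add: left_diff_distrib)
    also have "\<dots> \<le> (1 - 1 / b) * card (Ball k m)"
      using b card_image_le[OF finite_Ball, of "fmult w" k m]
      by (intro mult_left_mono) (auto simp: Y_def)
    finally show ?thesis
      by (simp add: Y_def)
  qed
  have "limsup (\<lambda>m. ereal (real (Max ((\<lambda>w. card (S \<inter> fmult w ` Ball k m)) ` FX k))
      / real (card (Ball k m)))) \<le> ereal (1 - 1 / b)"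
  proof (rule Limsup_bounded)
    show "\<forall>\<^sub>F m in sequentially. ereal (real (Max ((\<lambda>w. card (S \<inter> fmult w ` Ball k m)) ` FX k))
      / real (card (Ball k m))) \<le> ereal (1 - 1 / b)"
      using eventually_ge_at_top[of n]
    proof eventually_elim
      case (elim m)
      let ?M = "(\<lambda>w. card (S \<inter> fmult w ` Ball k m)) ` FX k"
      have "Max ?M \<in> ?M"
        using Nil_in_FX[of k] by (intro Max_in finite_card_translates) blast
      then have "real (Max ?M) \<le> (1 - 1 / b) * card (Ball k m)"
        using bound[OF elim] by auto
      then show ?case
        using card_Ball_pos[of k m] by (simp add: divide_le_eq)
    qed
  qed
  moreover have "ereal (1 - 1 / b) < 1"
    using b by simp
  ultimately show False
    using assms unfolding UB_generic_def by simp
qed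

lemma UB_genericI:
  assumes "\<And>n. \<exists>v\<in>FX k. fmult v ` Ball k n \<subseteq> S"
  shows "UB_generic k S"
proof -
  have "Max ((\<lambda>w. card (S \<inter> fmult w ` Ball k n)) ` FX k) = card (Ball k n)" for n
  proof (rule Max_eqI)
    obtain v where v: "v \<in> FX k" "fmult v ` Ball k n \<subseteq> S"
      using assms by blast
    have "inj_on (fmult v) (Ball k n)"
      using inj_on_fmult by (rule inj_on_subset) (auto simp: Ball_def)
    then have "card (S \<inter> fmult v ` Ball k n) = card (Ball k n)"
      using v(2) by (simp add: Int_absorb1 card_image)
    then show "card (Ball k n) \<in> (\<lambda>w. card (S \<inter> fmult w ` Ball k n)) ` FX k"
      using v(1) by (intro image_eqI[of _ _ v]) simp_all
  qed (auto simp: finite_card_translates card_Int_translate_le)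
  then have "(\<lambda>n. ereal (real (Max ((\<lambda>w. card (S \<inter> fmult w ` Ball k n)) ` FX k))
      / real (card (Ball k n)))) = (\<lambda>n. 1)"
    using card_Ball_pos[of k] by (simp add: fun_eq_iff)
  then show ?thesis
    unfolding UB_generic_def by (simp add: Limsup_const)
qed

section \<open>Word length in the group and in its free cover\<close>

locale generated_group = group G for G :: "('g, 'b) monoid_scheme" (structure) +
  fixes gen :: "nat \<Rightarrow> 'g" and k :: nat
  assumes gen_closed: "gen ` {..<k} \<subseteq> carrier G"
    and generate_gen: "generate G (gen ` {..<k}) = carrier G"
begin

definition letter_val :: "letter \<Rightarrow> 'g" where
  "letter_val a = (if snd a then inv (gen (fst a)) else gen (fst a))"

lemma letter_val_closed: "fst a < k \<Longrightarrow> letter_val a \<in> carrier G"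
  using gen_closed by (auto simp: letter_val_def)

lemma pi_word_Nil [simp]: "pi_word G gen [] = \<one>"
  by (simp add: pi_word_def)

lemma pi_word_Cons [simp]: "pi_word G gen (a # w) = letter_val a \<otimes> pi_word G gen w"
  by (cases a) (simp add: pi_word_def letter_val_def)

lemma pi_word_closed_aux: "(\<And>a. a \<in> set w \<Longrightarrow> fst a < k) \<Longrightarrow> pi_word G gen w \<in> carrier G"
  by (induction w) (auto intro: letter_val_closed)

lemma pi_word_closed [simp]: "w \<in> FX k \<Longrightarrow> pi_word G gen w \<in> carrier G"
  using pi_word_closed_aux FX_fst by blast

lemma pi_word_push:
  assumes "fst a < k" "\<And>b. b \<in> set w \<Longrightarrow> fst b < k"
  shows "pi_word G gen (push a w) = letter_val a \<otimes> pi_word G gen w"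
proof (cases w)
  case (Cons b u)
  have u: "pi_word G gen u \<in> carrier G"
    using assms(2) Cons by (intro pi_word_closed_aux) auto
  have "letter_val a \<otimes> (letter_val (flip a) \<otimes> x) = x" if "x \<in> carrier G" for x
    using gen_closed assms(1) that
    by (auto simp: letter_val_def flip_def m_assoc[symmetric] image_subset_iff)
  then show ?thesis
    using Cons u by (auto simp: cancels_iff_flip)
qed simp

lemma pi_word_fmult_aux:
  assumes "\<And>a. a \<in> set u \<Longrightarrow> fst a < k" "\<And>a. a \<in> set w \<Longrightarrow> fst a < k"
  shows "pi_word G gen (fmult u w) = pi_word G gen u \<otimes> pi_word G gen w"
  using assms(1)
proof (induction u)
  case Nil
  then show ?case
    using assms(2) by (simp add: pi_word_closed_aux)
next
  case (Cons a u)
  have "pi_word G gen (push a (fmult u w)) = letter_val a \<otimes> pi_word G gen (fmult u w)"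
  proof (rule pi_word_push)
    show "fst b < k" if "b \<in> set (fmult u w)" for b
      using set_fmult[of u w] that Cons.prems assms(2) by (meson UnE list.set_intros(2) subsetD)
  qed (use Cons.prems in simp)
  then show ?case
    using Cons assms(2) by (simp add: m_assoc letter_val_closed pi_word_closed_aux)
qed

lemma pi_word_fmult:
  "u \<in> FX k \<Longrightarrow> w \<in> FX k \<Longrightarrow> pi_word G gen (fmult u w) = pi_word G gen u \<otimes> pi_word G gen w"
  using pi_word_fmult_aux FX_fst by blast

lemma pi_word_inv:
  assumes "u \<in> FX k"
  shows "pi_word G gen (fmult (inv_word u) []) = inv (pi_word G gen u)"
proof -
  let ?v = "fmult (inv_word u) []"
  have "fmult ?v u = fmult (inv_word u) (fmult u [])"
    using assms by (simp add: fmult_assoc FX_reduced fmult_Nil_right)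
  then have "fmult ?v u = []"
    by (simp add: fmult_inv_left)
  then have "pi_word G gen ?v \<otimes> pi_word G gen u = \<one>"
    using pi_word_fmult[OF inv_in_FX[OF assms] assms] by simp
  then show ?thesis
    using inv_equality pi_word_closed assms inv_in_FX by metis
qed

lemma pi_word_surj:
  assumes "x \<in> carrier G"
  shows "\<exists>w\<in>FX k. pi_word G gen w = x"
proof -
  have gen: "\<exists>w\<in>FX k. pi_word G gen w = gen i" if "i < k" for i
    using that gen_closed by (intro bexI[of _ "[(i, False)]"]) (auto simp: FX_def letter_val_def)
  have "x \<in> generate G (gen ` {..<k})"
    using assms generate_gen by simp
  then show ?thesis
  proof induction
    case one
    show ?case by (intro bexI[of _ "[]"]) auto
  next
    case (incl h)
    then show ?case using gen by auto
  next
    case (inv h)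
    then obtain w where "w \<in> FX k" "pi_word G gen w = h"
      using gen by auto
    then show ?case
      using pi_word_inv inv_in_FX by metis
  next
    case (eng h1 h2)
    then show ?case
      using pi_word_fmult fmult_FX by metis
  qed
qed

lemma gamma_len_le: "v \<in> FX k \<Longrightarrow> pi_word G gen v = pi_word G gen w \<Longrightarrow> gamma_len G gen k w \<le> length v"
  unfolding gamma_len_def by (rule Least_le) blast

lemma gamma_len_attained:
  assumes "w \<in> FX k"
  obtains v where "v \<in> FX k" "length v = gamma_len G gen k w" "pi_word G gen v = pi_word G gen w"
proof -
  have "\<exists>m. \<exists>v\<in>FX k. length v = m \<and> pi_word G gen v = pi_word G gen w"
    using assms by blast
  from LeastI_ex[OF this] show ?thesis
    using that unfolding gamma_len_def by blast
qed

text \<open>The length is at most \<open>n\<close> iff the image of \<open>w\<close> is inverse to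
  that of some word in the \<open>n\<close>-ball, which is closed under inversion. This reduces
  being far from 1 to finitely many instances of the word problem.\<close>

lemma less_gamma_len_iff:
  assumes "w \<in> FX k"
  shows "n < gamma_len G gen k w \<longleftrightarrow> (\<forall>u\<in>Ball k n. pi_word G gen (fmult w u) \<noteq> \<one>)"
proof
  assume n: "n < gamma_len G gen k w"
  show "\<forall>u\<in>Ball k n. pi_word G gen (fmult w u) \<noteq> \<one>"
  proof (intro ballI notI)
    fix u assume u: "u \<in> Ball k n" and "pi_word G gen (fmult w u) = \<one>"
    then have "inv (pi_word G gen u) = pi_word G gen w"
      using pi_word_fmult[OF assms Ball_FX[OF u]] assms Ball_FX[OF u]
      by (intro inv_equality) auto
    then have "gamma_len G gen k w \<le> length (fmult (inv_word u) [])"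
      using pi_word_inv[OF Ball_FX[OF u]] inv_in_FX[OF Ball_FX[OF u]]
      by (intro gamma_len_le) auto
    then show False
      using n Ball_length[OF inv_in_Ball[OF u]] by simp
  qed
next
  assume *: "\<forall>u\<in>Ball k n. pi_word G gen (fmult w u) \<noteq> \<one>"
  obtain v where v: "v \<in> FX k" "length v = gamma_len G gen k w"
    "pi_word G gen v = pi_word G gen w"
    using gamma_len_attained[OF assms] .
  show "n < gamma_len G gen k w"
  proof (rule ccontr)
    assume "\<not> ?thesis"
    then have "fmult (inv_word v) [] \<in> Ball k n"
      using v by (intro inv_in_Ball) (simp add: Ball_def)
    then have "pi_word G gen (fmult w (fmult (inv_word v) [])) \<noteq> \<one>"
      using * by blast
    moreover have "pi_word G gen (fmult w (fmult (inv_word v) [])) = \<one>"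
      using v pi_word_fmult[OF assms inv_in_FX[OF v(1)]] pi_word_inv[OF v(1)] assms
      by (simp add: r_inv)
    ultimately show False by blast
  qed
qed

text \<open>Otherwise the finite \<open>n\<close>-ball would map onto the infinite group.\<close>

lemma gamma_len_unbounded:
  assumes "infinite (carrier G)"
  shows "\<exists>w\<in>FX k. n < gamma_len G gen k w"
proof (rule ccontr)
  assume *: "\<not> ?thesis"
  have "carrier G \<subseteq> pi_word G gen ` Ball k n"
  proof
    fix x assume "x \<in> carrier G"
    then obtain w where w: "w \<in> FX k" "pi_word G gen w = x"
      using pi_word_surj by blast
    obtain v where "v \<in> FX k" "length v = gamma_len G gen k w" "pi_word G gen v = pi_word G gen w"
      using gamma_len_attained[OF w(1)] .
    then show "x \<in> pi_word G gen ` Ball k n"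
      using w * by (intro image_eqI[of _ _ v]) (auto simp: Ball_def)
  qed
  then show False
    using assms finite_Ball finite_subset by blast
qed

text \<open>The triangle inequality for x = v^(-1) (v x).\<close>

lemma gamma_len_fmult_right_le:
  assumes "v \<in> FX k" "x \<in> FX k"
  shows "gamma_len G gen k x \<le> gamma_len G gen k v + gamma_len G gen k (fmult v x)"
proof -
  obtain a where a: "a \<in> FX k" "length a = gamma_len G gen k v"
    "pi_word G gen a = pi_word G gen v"
    using gamma_len_attained[OF assms(1)] .
  obtain b where b: "b \<in> FX k" "length b = gamma_len G gen k (fmult v x)"
    "pi_word G gen b = pi_word G gen (fmult v x)"
    using gamma_len_attained[OF fmult_FX[OF assms]] .
  let ?c = "fmult (fmult (inv_word a) []) b"
  have "pi_word G gen ?c = pi_word G gen x"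
    using a b assms pi_word_fmult[OF inv_in_FX[OF a(1)] b(1)] pi_word_inv[OF a(1)]
    by (simp add: pi_word_fmult m_assoc[symmetric])
  then have "gamma_len G gen k x \<le> length ?c"
    using fmult_FX[OF inv_in_FX[OF a(1)] b(1)] by (intro gamma_len_le)
  also have "\<dots> \<le> length a + length b"
    using length_fmult[of "fmult (inv_word a) []" b] length_fmult[of "inv_word a" "[]"] by simp
  finally show ?thesis
    using a(2) b(2) by simp
qed

text \<open>Take x of length over 2 n in \<Gamma> and v such that \<open>S\<close> contains the ball
  of radius |x| + n about v. This ball contains the \<open>n\<close>-balls about v and v x, and by
  the triangle inequality these centres cannot both have length at most n.\<close>

lemma translate_far_from_one:
  assumes "infinite (carrier G)" "\<And>n. \<exists>v\<in>FX k. fmult v ` Ball k n \<subseteq> S"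
  shows "\<exists>v\<in>FX k. fmult v ` Ball k n \<subseteq> S \<and> n < gamma_len G gen k v"
proof -
  obtain x where x: "x \<in> FX k" "2 * n < gamma_len G gen k x"
    using gamma_len_unbounded[OF assms(1)] by blast
  obtain v where v: "v \<in> FX k" "fmult v ` Ball k (length x + n) \<subseteq> S"
    using assms(2) by blast
  show ?thesis
  proof (cases "n < gamma_len G gen k v")
    case True
    moreover have "fmult v ` Ball k n \<subseteq> S"
      using v(2) Ball_mono[of n "length x + n" k] by (meson image_mono le_add2 order_trans)
    ultimately show ?thesis
      using v(1) by blast
  next
    case False
    then have "n < gamma_len G gen k (fmult v x)"
      using gamma_len_fmult_right_le[OF v(1) x(1)] x(2) by simp
    moreover have "fmult (fmult v x) ` Ball k n \<subseteq> S"
    proof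
      fix y assume "y \<in> fmult (fmult v x) ` Ball k n"
      then obtain u where u: "u \<in> Ball k n" "y = fmult (fmult v x) u"
        by blast
      then have "y = fmult v (fmult x u)"
        using fmult_assoc[OF FX_reduced[OF Ball_FX[OF u(1)]]] by simp
      moreover have "fmult x u \<in> Ball k (length x + n)"
        using x(1) u(1) by (intro fmult_in_Ball) (simp_all add: Ball_def)
      ultimately show "y \<in> S"
        using v(2) by blast
    qed
    ultimately show ?thesis
      using fmult_FX[OF v(1) x(1)] by blast
  qed
qed

end

section \<open>Computable sequences of words\<close>

text \<open>Composition evaluates its inner functions even if their values are discarded. The term
  thus halts exactly where \<open>r\<close> does and turns a semi-decision procedure into the
  constant answer 1, that is, "nontrivial".\<close>

lemma evalr_Suc_Zf: "evalr (Cn (Cn Sf [Zf]) [r]) [x] y \<longleftrightarrow> y = 1 \<and> (\<exists>z. evalr r [x] z)"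
proof
  assume "evalr (Cn (Cn Sf [Zf]) [r]) [x] y"
  then obtain ys where ys: "length ys = 1" "evalr r [x] (ys ! 0)" "evalr (Cn Sf [Zf]) ys y"
    by (auto elim: evalr_CnE)
  from ys(3) have "y = 1"
    by (auto elim!: evalr_CnE evalr_SfE evalr_ZfE)
  then show "y = 1 \<and> (\<exists>z. evalr r [x] z)"
    using ys(2) by blast
next
  assume "y = 1 \<and> (\<exists>z. evalr r [x] z)"
  then obtain z where z: "evalr r [x] z" and y: "y = 1"
    by blast
  have "evalr (Cn Sf [Zf]) [z] (Suc 0)"
    by (rule evalr.comp[of "[0]"]) (auto intro: evalr.zero evalr.suc)
  then show "evalr (Cn (Cn Sf [Zf]) [r]) [x] y"
    unfolding y using z by (intro evalr.comp[of "[z]" "[r]"]) auto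
qed

lemma digit_words_Ball: "fmult (digit_words k n d) [] \<in> Ball k n"
  using fmult_in_FX[of "digit_words k n d" k "[]"] fst_digit_words[of _ k n d]
    length_fmult[of "digit_words k n d" "[]"] length_digit_words[of k n d]
  by (simp add: Ball_def)

text \<open>With \<open>digit_words_Ball\<close>, the numbers below \<open>(2 * k + 1) ^ n\<close>
  enumerate exactly the ball, so a condition on all its elements becomes a bounded sum.\<close>

lemma Ball_digit_words:
  assumes "u \<in> Ball k n"
  obtains d where "d < (2 * k + 1) ^ n" "fmult (digit_words k n d) [] = u"
proof -
  obtain d where d: "d < (2 * k + 1) ^ length u" "digit_words k (length u) d = u"
    using digit_words_surj[of u k] FX_fst[OF Ball_FX[OF assms]] by blast
  have "digit_words k n d = u"
    using digit_words_extend[OF d(1) Ball_length[OF assms]] d(2) by simp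
  moreover have "(2 * k + 1) ^ length u \<le> (2 * k + 1) ^ n"
    using Ball_length[OF assms] by (intro power_increasing) auto
  moreover have "fmult u [] = u"
    using assms by (intro fmult_Nil_right FX_reduced Ball_FX)
  ultimately show ?thesis
    using d(1) by (intro that[of d]) simp_all
qed

lemma FX_digit_words:
  assumes "w \<in> FX k"
  obtains c where "digit_words k c c = w"
  using digit_words_surj_self[of w k] FX_fst[OF assms] by blast

lemma mult_code_Nil: "mult_code k i c 0 = code (fmult (digit_words k i c) [])"
  using mult_code[of k i c "[]"] by simp

lemma mult_code_mult_code:
  "mult_code k c c (mult_code k n d 0) =
    code (fmult (digit_words k c c) (fmult (digit_words k n d) []))"
  by (simp add: mult_code_Nil mult_code)

lemma computable_seq_rec_fun:
  "computable_seq k \<omega> \<longleftrightarrow> (\<forall>n. \<omega> n \<in> FX k) \<and> rec_fun 1 (\<lambda>e. code (\<omega> (e ! 0)))"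
proof -
  have "(\<exists>r. \<forall>n. evalr r [n] (code (\<omega> n))) \<longleftrightarrow>
      (\<exists>r. \<forall>xs. length xs = 1 \<longrightarrow> evalr r xs (code (\<omega> (xs ! 0))))"
    by (intro arg_cong[of _ _ Ex] ext iffI) (force simp: length_Suc_conv)+
  then show ?thesis
    unfolding computable_seq_def rec_fun_def by simp
qed

lemma rec_fun_seq:
  assumes "rec_fun 1 (\<lambda>e. F (e ! 0))" "rec_fun n a"
  shows "rec_fun n (\<lambda>e. F (a e))"
  using rec_fun_comp1[OF assms] by simp

text \<open>A translate of the \<open>n\<close>-ball on which \<open>r\<close> halts everywhere with answer "nontrivial" is found by
  dovetailing over pairs of a translation and a number of steps.\<close>

lemma computable_seq_search:
  assumes "\<And>n. \<exists>v\<in>FX k. \<forall>u\<in>Ball k n. \<exists>y. evalr r [code (fmult v u)] (Suc y)"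
  obtains \<omega> where "computable_seq k \<omega>"
    "\<And>n u. u \<in> Ball k n \<Longrightarrow> \<exists>y. evalr r [code (fmult (\<omega> n) u)] (Suc y)"
proof -
  obtain t where t: "approx r 1 t"
    using approx_exists by blast
  have t_rec: "rec_fun n (\<lambda>e. t [a e, b e])" if "rec_fun n a" "rec_fun n b" for n a b
    using approx_rec_fun[OF t] that by (intro rec_fun_comp2) (simp_all add: numeral_2_eq_2)
  \<comment> \<open>\<open>m\<close> encodes the number naming v together with a step bound. As
    before, \<open>2 - t\<close> vanishes iff \<open>r\<close> has halted with a positive value, so
    the sum is 0 iff this holds on the whole translate.\<close>
  define p where "p m n = (\<Sum>d<(2 * k + 1) ^ n. 2 - t [psnd m,
    mult_code k (pfst m) (pfst m) (mult_code k n d 0)])" for m n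
  have "rec_fun (Suc 1) (\<lambda>e. p (e ! 0) (e ! 1))"
    unfolding p_def by (intro rec_intros t_rec) simp_all
  then have rec: "rec_fun 1 (\<lambda>e. LEAST m. p ((m # e) ! 0) ((m # e) ! 1) = 0)"
    if "\<And>n. \<exists>m. p m n = 0"
    using that by (intro rec_fun_Least) simp_all
  have ex: "\<exists>m. p m n = 0" for n
  proof -
    obtain v where v: "v \<in> FX k" "\<And>u. u \<in> Ball k n \<Longrightarrow> \<exists>y. evalr r [code (fmult v u)] (Suc y)"
      using assms by blast
    obtain c where c: "digit_words k c c = v"
      using FX_digit_words[OF v(1)] .
    define x where "x d = code (fmult v (fmult (digit_words k n d) []))" for d
    have "\<exists>s. t [s, x d] \<ge> 2" for d
    proof -
      obtain y where "evalr r [x d] (Suc y)"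
        using v(2)[OF digit_words_Ball[of k n d]] unfolding x_def by blast
      then obtain s where "t [s, x d] = Suc (Suc y)"
        using approx_complete[OF t, of "[x d]"] by auto
      then show ?thesis
        by (intro exI[of _ s]) simp
    qed
    then obtain S where S: "\<And>d. t [S d, x d] \<ge> 2"
      by metis
    define s where "s = (\<Sum>d<(2 * k + 1) ^ n. S d)"
    have "t [s, x d] \<ge> 2" if "d < (2 * k + 1) ^ n" for d
    proof -
      have "S d \<le> s"
        unfolding s_def using that by (intro member_le_sum) auto
      moreover obtain y where y: "t [S d, x d] = Suc y"
        using S[of d] by (cases "t [S d, x d]") auto
      ultimately have "t [s, x d] = Suc y"
        using approx_mono[OF t, of "[x d]" "S d" y s] by simp
      then show ?thesis
        using S[of d] y by simp
    qed
    then have "p (prod_encode (c, s)) n = 0"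
      by (simp add: p_def mult_code_mult_code c x_def)
    then show ?thesis ..
  qed
  define f where "f n = (LEAST m. p m n = 0)" for n
  define \<omega> where "\<omega> n = fmult (digit_words k (pfst (f n)) (pfst (f n))) []" for n
  have f: "p (f n) n = 0" for n
    unfolding f_def using ex by (rule LeastI_ex)
  have "rec_fun 1 (\<lambda>e. f (e ! 0))"
    using rec[OF ex] by (simp add: f_def)
  then have "rec_fun 1 (\<lambda>e. mult_code k (pfst (f (e ! 0))) (pfst (f (e ! 0))) 0)"
    by (intro rec_intros)
  then have "rec_fun 1 (\<lambda>e. code (\<omega> (e ! 0)))"
    by (simp add: mult_code_Nil \<omega>_def)
  moreover have FX: "\<omega> n \<in> FX k" for n
    using digit_words_Ball[THEN Ball_FX] by (simp add: \<omega>_def)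
  ultimately have "computable_seq k \<omega>"
    by (simp add: computable_seq_rec_fun)
  moreover have "\<exists>y. evalr r [code (fmult (\<omega> n) u)] (Suc y)" if u: "u \<in> Ball k n" for n u
  proof -
    obtain d where d: "d < (2 * k + 1) ^ n" "fmult (digit_words k n d) [] = u"
      using Ball_digit_words[OF u] .
    let ?x = "code (fmult (\<omega> n) u)"
    have "fmult (\<omega> n) u = fmult (digit_words k (pfst (f n)) (pfst (f n))) u"
      using u by (simp add: \<omega>_def fmult_assoc FX_reduced[OF Ball_FX])
    moreover have "2 - t [psnd (f n), mult_code k (pfst (f n)) (pfst (f n)) (mult_code k n d 0)] = 0"
      using f[of n] d(1) unfolding p_def by (simp add: sum_eq_0_iff)
    ultimately have "t [psnd (f n), ?x] \<ge> 2"
      using d(2) by (simp add: mult_code_mult_code)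
    then obtain y where "t [psnd (f n), ?x] = Suc (Suc y)"
      by (auto simp: numeral_2_eq_2 Suc_le_eq gr0_conv_Suc less_iff_Suc_add)
    then have "evalr r [?x] (Suc y)"
      by (intro approx_sound[OF t]) simp_all
    then show ?thesis ..
  qed
  ultimately show ?thesis
    using that by blast
qed

text \<open>\<open>mult_code\<close> needs the left factor as a digit number, whereas the sequence
  yields only a code. A witness \<open>m\<close> therefore consists of \<open>n\<close>, a guessed
  digit number for \<omega>_n, checked by comparing codes, and one for the element of the
  ball.\<close>

lemma ce_words_translates:
  assumes "computable_seq k \<omega>"
  shows "ce_words (\<Union>n. fmult (\<omega> n) ` Ball k n)" (is "ce_words ?S")
proof -
  define W where "W n = code (\<omega> n)" for n
  have W: "rec_fun 1 (\<lambda>e. W (e ! 0))" and FX: "\<And>n. \<omega> n \<in> FX k"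
    using assms unfolding computable_seq_rec_fun W_def by auto
  define c d where "c m = pfst (psnd m)" and "d m = psnd (psnd m)" for m
  define p where "p m x = (if W (pfst m) = mult_code k (c m) (c m) 0
    then if mult_code k (c m) (c m) (mult_code k (pfst m) (d m) 0) = x then 0 else 1
    else (1 :: nat))" for m x
  have "rec_fun 2 (\<lambda>e. p (e ! 0) (e ! 1))"
    unfolding p_def c_def d_def by (intro rec_intros rec_fun_seq[OF W]) simp_all
  moreover have "code ` ?S = {x. \<exists>m. p m x = 0}"
  proof (intro equalityI subsetI)
    fix x assume "x \<in> code ` ?S"
    then obtain n u where u: "u \<in> Ball k n" "x = code (fmult (\<omega> n) u)"
      by blast
    obtain a where a: "digit_words k a a = \<omega> n"
      using FX_digit_words[OF FX] .
    obtain b where b: "fmult (digit_words k n b) [] = u"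
      using Ball_digit_words[OF u(1)] .
    have "p (prod_encode (n, prod_encode (a, b))) x = 0"
      using a b u(2) FX[of n]
      by (simp add: p_def c_def d_def W_def mult_code mult_code_Nil
          fmult_Nil_right FX_reduced)
    then show "x \<in> {x. \<exists>m. p m x = 0}"
      by blast
  next
    fix x assume "x \<in> {x. \<exists>m. p m x = 0}"
    then obtain m where m: "p m x = 0"
      by blast
    define n where "n = pfst m"
    define u where "u = fmult (digit_words k n (d m)) []"
    have u: "u \<in> Ball k n"
      unfolding u_def by (rule digit_words_Ball)
    have "code (\<omega> n) = code (fmult (digit_words k (c m) (c m)) [])"
      and x: "x = code (fmult (digit_words k (c m) (c m)) u)"
      using m by (auto simp: p_def W_def mult_code mult_code_Nil n_def u_def
          split: if_splits)
    then have "\<omega> n = fmult (digit_words k (c m) (c m)) []"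
      using inj_code by (simp add: inj_eq)
    then have "x = code (fmult (\<omega> n) u)"
      using u x by (simp add: fmult_assoc FX_reduced[OF Ball_FX])
    then show "x \<in> code ` ?S"
      using u by blast
  qed
  ultimately show ?thesis
    unfolding ce_words_def using ce_set_Collect_ex[of p] by simp
qed

lemma computable_seq_Suc:
  assumes "computable_seq k \<omega>"
  shows "computable_seq k (\<lambda>n. \<omega> (Suc n))"
  using assms rec_fun_seq[of "\<lambda>n. code (\<omega> n)" 1 "\<lambda>e. Suc (e ! 0)"]
  unfolding computable_seq_rec_fun by (simp add: rec_intros)

text \<open>Indexing by the code of the previous term keeps the recursion on numbers: it is
  primitive recursion with step n \<mapsto> code of \<omega>_n.\<close>

lemma computable_seq_iterate:
  assumes "computable_seq k \<omega>"
  shows "computable_seq k (rec_nat (\<omega> 0) (\<lambda>_ w. \<omega> (code w)))" (is "computable_seq k ?\<chi>")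
proof -
  define W where "W n = code (\<omega> n)" for n
  have W: "rec_fun 1 (\<lambda>e. W (e ! 0))" and FX: "\<And>n. \<omega> n \<in> FX k"
    using assms unfolding computable_seq_rec_fun W_def by auto
  have "rec_fun 1 (\<lambda>e. rec_nat (W 0) (\<lambda>_ y. W y) (e ! 0))"
    by (intro rec_intros rec_fun_seq[OF W]) simp_all
  moreover have "rec_nat (W 0) (\<lambda>_ y. W y) n = code (?\<chi> n)" for n
    by (induction n) (simp_all add: W_def)
  moreover have "?\<chi> n \<in> FX k" for n
    by (cases n) (simp_all add: FX)
  ultimately show ?thesis
    unfolding computable_seq_rec_fun by simp
qed

section \<open>The implications between the four conditions\<close>

context generated_group
begin

lemma UB_generic_WP_imp_far_seq:
  assumes "infinite (carrier G)" "UB_generic_WP G gen k"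
  shows "\<exists>\<omega>. computable_seq k \<omega> \<and> (\<forall>n. gamma_len G gen k (\<omega> n) > n)"
proof -
  obtain S r where S: "S \<subseteq> FX k" "UB_generic k S"
    and halt: "\<And>w. w \<in> S \<Longrightarrow> \<exists>y. evalr r [code w] y"
    and correct: "\<And>w y. w \<in> FX k \<Longrightarrow> evalr r [code w] y \<Longrightarrow> y = 0 \<longleftrightarrow> pi_word G gen w = \<one>"
    using assms(2) unfolding UB_generic_WP_def WP_solvable_on_def by metis
  have "\<exists>v\<in>FX k. \<forall>u\<in>Ball k n. \<exists>y. evalr r [code (fmult v u)] (Suc y)" for n
  proof -
    obtain v where v: "v \<in> FX k" "fmult v ` Ball k n \<subseteq> S" "n < gamma_len G gen k v"
      using translate_far_from_one[OF assms(1) UB_generic_contains_translate[OF S(2)]] by blast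
    have "\<exists>y. evalr r [code (fmult v u)] (Suc y)" if u: "u \<in> Ball k n" for u
    proof -
      obtain y where y: "evalr r [code (fmult v u)] y"
        using halt v(2) u by blast
      moreover have "pi_word G gen (fmult v u) \<noteq> \<one>"
        using less_gamma_len_iff[OF v(1)] v(3) u by blast
      ultimately have "y \<noteq> 0"
        using correct fmult_FX[OF v(1) Ball_FX[OF u]] by blast
      then show ?thesis
        using y not0_implies_Suc by blast
    qed
    then show ?thesis
      using v(1) by blast
  qed
  then obtain \<omega> where \<omega>: "computable_seq k \<omega>"
    "\<And>n u. u \<in> Ball k n \<Longrightarrow> \<exists>y. evalr r [code (fmult (\<omega> n) u)] (Suc y)"
    using computable_seq_search by blast
  have "gamma_len G gen k (\<omega> n) > n" for n
  proof -
    have FX: "\<omega> n \<in> FX k"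
      using \<omega>(1) by (simp add: computable_seq_def)
    show ?thesis
      unfolding less_gamma_len_iff[OF FX]
      using \<omega>(2) correct fmult_FX[OF FX Ball_FX] by blast
  qed
  then show ?thesis
    using \<omega>(1) by blast
qed

lemma far_seq_imp_ce_UB_generic:
  assumes "computable_seq k \<omega>" "\<And>n. gamma_len G gen k (\<omega> n) > n"
  shows "\<exists>S\<subseteq>FX k. ce_words S \<and> UB_generic k S \<and> S \<inter> ker_pi G gen k = {}"
proof (intro exI conjI)
  let ?S = "\<Union>n. fmult (\<omega> n) ` Ball k n"
  have FX: "\<omega> n \<in> FX k" for n
    using assms(1) by (simp add: computable_seq_def)
  show "?S \<subseteq> FX k"
    using fmult_FX[OF FX] Ball_FX by blast
  show "ce_words ?S"
    using assms(1) by (rule ce_words_translates)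
  show "UB_generic k ?S"
    using FX by (intro UB_genericI) blast
  show "?S \<inter> ker_pi G gen k = {}"
    using assms(2) less_gamma_len_iff[OF FX] unfolding ker_pi_def by blast
qed

text \<open>A procedure that halts exactly on \<open>S\<close> may always answer "nontrivial",
  because \<open>S\<close> misses the kernel.\<close>

lemma ce_UB_generic_imp_UB_generic_WP:
  assumes "S \<subseteq> FX k" "ce_words S" "UB_generic k S" "S \<inter> ker_pi G gen k = {}"
  shows "UB_generic_WP G gen k"
proof -
  obtain r where r: "\<And>x. x \<in> code ` S \<longleftrightarrow> (\<exists>y. evalr r [x] y)"
    using assms(2) unfolding ce_words_def ce_set_def by blast
  have S: "w \<in> S \<longleftrightarrow> (\<exists>y. evalr r [code w] y)" for w
    using r[of "code w"] inj_image_mem_iff[OF inj_code] by blast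
  have "pi_word G gen w \<noteq> \<one>" if "w \<in> S" for w
    using assms(1,4) that unfolding ker_pi_def by blast
  then have "WP_solvable_on G gen k S"
    unfolding WP_solvable_on_def evalr_Suc_Zf
    by (intro exI[of _ "Cn (Cn Sf [Zf]) [r]"]) (auto simp: evalr_Suc_Zf S)
  then show ?thesis
    using assms(1,3) unfolding UB_generic_WP_def by blast
qed

lemma far_seq_iff_increasing_seq:
  "(\<exists>\<omega>. computable_seq k \<omega> \<and> (\<forall>n. gamma_len G gen k (\<omega> n) > n)) \<longleftrightarrow>
   (\<exists>\<omega>. computable_seq k \<omega> \<and> (\<forall>n. gamma_len G gen k (\<omega> (Suc n)) > gamma_len G gen k (\<omega> n)))"
proof
  assume "\<exists>\<omega>. computable_seq k \<omega> \<and> (\<forall>n. gamma_len G gen k (\<omega> n) > n)"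
  then obtain \<omega> where \<omega>: "computable_seq k \<omega>" "\<And>n. gamma_len G gen k (\<omega> n) > n"
    by blast
  \<comment> \<open>If \<omega> exceeds every index, its term at index \<open>code w\<close> is
    longer in \<Gamma> than \<open>w\<close>, since |w|_\<Gamma> \<le> |w| \<le>
    \<open>code w\<close>.\<close>
  define \<chi> where "\<chi> = rec_nat (\<omega> 0) (\<lambda>_ w. \<omega> (code w))"
  have \<chi>: "computable_seq k \<chi>"
    unfolding \<chi>_def using \<omega>(1) by (rule computable_seq_iterate)
  have "gamma_len G gen k (\<chi> n) < gamma_len G gen k (\<chi> (Suc n))" for n
  proof -
    have "gamma_len G gen k (\<chi> n) \<le> length (\<chi> n)"
      using \<chi> by (intro gamma_len_le) (simp_all add: computable_seq_def)
    also have "\<dots> \<le> code (\<chi> n)"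
      by (rule length_le_code)
    also have "\<dots> < gamma_len G gen k (\<omega> (code (\<chi> n)))"
      by (rule \<omega>(2))
    finally show ?thesis
      by (simp add: \<chi>_def)
  qed
  then show "\<exists>\<omega>. computable_seq k \<omega> \<and>
      (\<forall>n. gamma_len G gen k (\<omega> (Suc n)) > gamma_len G gen k (\<omega> n))"
    using \<chi> by blast
next
  assume "\<exists>\<omega>. computable_seq k \<omega> \<and>
      (\<forall>n. gamma_len G gen k (\<omega> (Suc n)) > gamma_len G gen k (\<omega> n))"
  then obtain \<omega> where \<omega>: "computable_seq k \<omega>"
    "\<And>n. gamma_len G gen k (\<omega> (Suc n)) > gamma_len G gen k (\<omega> n)"
    by blast
  \<comment> \<open>The first length may be 0, so only the weak inequality holds; shifting the
    sequence by one makes it strict.\<close>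
  have "n \<le> gamma_len G gen k (\<omega> n)" for n
    by (rule strict_mono_imp_increasing) (simp add: strict_mono_Suc_iff \<omega>(2))
  then have "n < gamma_len G gen k (\<omega> (Suc n))" for n
    by (simp add: Suc_le_lessD)
  then show "\<exists>\<omega>. computable_seq k \<omega> \<and> (\<forall>n. gamma_len G gen k (\<omega> n) > n)"
    using computable_seq_Suc[OF \<omega>(1)] by blast
qed

end

theorem theorem4p1:
  fixes G :: "('g, 'b) monoid_scheme" and gen :: "nat \<Rightarrow> 'g" and k :: nat
  assumes "group G"
    and "gen ` {..<k} \<subseteq> carrier G"
    and "generate G (gen ` {..<k}) = carrier G"
    and "infinite (carrier G)"
  shows "(UB_generic_WP G gen k
            \<longleftrightarrow> (\<exists>S \<subseteq> FX k. ce_words S \<and> UB_generic k S \<and> S \<inter> ker_pi G gen k = {}))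
       \<and> (UB_generic_WP G gen k
            \<longleftrightarrow> (\<exists>\<omega>. computable_seq k \<omega> \<and> (\<forall>n. gamma_len G gen k (\<omega> n) > n)))
       \<and> (UB_generic_WP G gen k
            \<longleftrightarrow> (\<exists>\<omega>. computable_seq k \<omega> \<and>
                   (\<forall>n. gamma_len G gen k (\<omega> (Suc n)) > gamma_len G gen k (\<omega> n))))"
    (is "(?A \<longleftrightarrow> ?B) \<and> (?A \<longleftrightarrow> ?C) \<and> (?A \<longleftrightarrow> ?D)")
proof -
  interpret group G by fact
  interpret generated_group G gen k
    by unfold_locales fact+
  have "?A \<Longrightarrow> ?C"
    using UB_generic_WP_imp_far_seq[OF assms(4)] .
  moreover have "?C \<Longrightarrow> ?B"
    using far_seq_imp_ce_UB_generic by blast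
  moreover have "?B \<Longrightarrow> ?A"
    using ce_UB_generic_imp_UB_generic_WP by blast
  moreover have "?C \<longleftrightarrow> ?D"
    by (rule far_seq_iff_increasing_seq)
  ultimately show ?thesis
    by argo
qed

end
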